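(* There is an absolute constant $C>0$ such that for every integer $R\ge2$ and every irrational $\alpha\in(0,\tfrac12)$ whose nearest integer continued fraction expansion is (eventually) periodic with period block $(\varepsilon_ia_i)=-R,\,R,\,-(R+1),\,R+1$, one has $$\left|\rho(\alpha)-\tfrac14\left(1-\tfrac3R+\tfrac{4}{R^2}\right)\right|\le \tfrac{C}{R^3}\ \text{ if $R$ is even},\qquad \left|\rho(\alpha)-\tfrac14\left(1-\tfrac3R+\tfrac{5}{R^2}\right)\right|\le \tfrac{C}{R^3}\ \text{ if $R$ is odd}.$$
   Context: For real $x$, $\|x\|$ is the distance to the nearest integer and $\{x\}$ the fractional part. $M(\alpha,\gamma):=\liminf_{|n|\to\infty}|n|\,\|n\alpha-\gamma\|$ ($n\in\mathbb Z$), and $\rho(\alpha):=\sup\{M(\alpha,\gamma):\gamma\in\mathbb R\setminus(\mathbb Z+\alpha\mathbb Z)\}$. Nearest integer continued fraction expansion of irrational $\alpha\in(0,\tfrac12)$: $a_0=0$, $\varepsilon_1=1$, $\alpha_0=\alpha$; for $i\ge0$, if $\|1/\alpha_i\|=\{1/\alpha_i\}$ then $a_{i+1}=\lfloor1/\alpha_i\rfloor$, $\varepsilon_{i+2}=1$, else $a_{i+1}=\lceil1/\alpha_i\rceil$, $\varepsilon_{i+2}=-1$; and $\alpha_{i+1}=\|1/\alpha_i\|$. Thus $\alpha=a_0+\cfrac{\varepsilon_1}{a_1+\cfrac{\varepsilon_2}{a_2+\cdots}}$, and the expansion is described by the sequence of signed partial quotients $\varepsilon_ia_i$. *)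

theory Defs
  imports "HOL-Library.Extended_Real"
begin

definition dist_nint :: "real \<Rightarrow> real" where
  "dist_nint x = \<bar>x - of_int (round x)\<bar>"

text \<open>The lower limit and the supremum are taken in the extended reals, where they always exist.\<close>

definition inhom_M :: "real \<Rightarrow> real \<Rightarrow> ereal" where
  "inhom_M \<alpha> \<gamma> =
     Liminf (filtercomap (\<lambda>n::int. \<bar>n\<bar>) at_top)
       (\<lambda>n. ereal (\<bar>of_int n\<bar> * dist_nint (of_int n * \<alpha> - \<gamma>)))"

definition inhom_rho :: "real \<Rightarrow> ereal" where
  "inhom_rho \<alpha> =
     Sup {inhom_M \<alpha> \<gamma> | \<gamma>. \<gamma> \<notin> {of_int m + \<alpha> * of_int n | m n :: int. True}}"

primrec nicf_rem :: "real \<Rightarrow> nat \<Rightarrow> real" where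
  "nicf_rem \<alpha> 0 = \<alpha>"
| "nicf_rem \<alpha> (Suc i) = dist_nint (1 / nicf_rem \<alpha> i)"

fun nicf_a :: "real \<Rightarrow> nat \<Rightarrow> int" where
  "nicf_a \<alpha> 0 = 0"
| "nicf_a \<alpha> (Suc i) =
     (if dist_nint (1 / nicf_rem \<alpha> i) = frac (1 / nicf_rem \<alpha> i)
      then \<lfloor>1 / nicf_rem \<alpha> i\<rfloor> else \<lceil>1 / nicf_rem \<alpha> i\<rceil>)"

text \<open>The signs are indexed from \<open>1\<close>; the value at \<open>0\<close> is a dummy.\<close>

fun nicf_eps :: "real \<Rightarrow> nat \<Rightarrow> int" where
  "nicf_eps \<alpha> 0 = 1"
| "nicf_eps \<alpha> (Suc 0) = 1"
| "nicf_eps \<alpha> (Suc (Suc i)) =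
     (if dist_nint (1 / nicf_rem \<alpha> i) = frac (1 / nicf_rem \<alpha> i) then 1 else - 1)"

definition nicf_signed :: "real \<Rightarrow> nat \<Rightarrow> int" where
  "nicf_signed \<alpha> i = nicf_eps \<alpha> i * nicf_a \<alpha> i"

definition eventually_periodic_with :: "'a list \<Rightarrow> (nat \<Rightarrow> 'a) \<Rightarrow> bool" where
  "eventually_periodic_with b s \<longleftrightarrow> (\<exists>N. \<forall>k. s (N + k) = b ! (k mod length b))"

end

theory Submission
  imports Defs
begin

text \<open>
  The convergents give, at each level \<open>k\<close>, a basis of the lattice \<open>{(n, n\<alpha> - m)}\<close>. After rescaling the two
  axes it is nearly orthonormal: the off-diagonal entries \<open>r k\<close> and \<open>b k\<close> are about \<open>1/R\<close>. In this basis the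
  grid belonging to \<open>\<gamma>\<close> is \<open>(x, y) + \<int>\<^sup>2\<close>, and \<open>|n| |n\<alpha> - \<gamma> - m|\<close> becomes the form \<open>corner\<close>. Its value is at most
  about \<open>1/4\<close>, and to come within \<open>O(1/R)\<close> of \<open>1/4\<close> at every level the grid must be \<open>(1/2 + s, 1/2 + t) + \<int>\<^sup>2\<close>
  with \<open>s, t = O(1/R)\<close>; then only its four points near \<open>(\<plusminus>1/2, \<plusminus>1/2)\<close> matter.

  Let \<open>A\<close> be the odd and \<open>B\<close> the even one of \<open>R\<close>, \<open>R + 1\<close>. Passing from one level to the next turns the shifts into a
  sequence \<open>s\<^sub>j\<close> with \<open>A s\<^sub>0 = h\<^sub>0 + s\<^sub>1 - s\<^sub>-\<^sub>1\<close>, \<open>A s\<^sub>1 = h\<^sub>1 - s\<^sub>0 - s\<^sub>2\<close>, \<open>B s\<^sub>2 = h\<^sub>2 + s\<^sub>3 - s\<^sub>1\<close>,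
  \<open>B s\<^sub>3 = h\<^sub>3 - s\<^sub>2 - s\<^sub>4\<close> over each period, where \<open>h\<^sub>0, h\<^sub>1 \<in> 1/2 + \<int>\<close> and \<open>h\<^sub>2, h\<^sub>3 \<in> \<int>\<close>. So \<open>\<gamma>\<close> is encoded by the \<open>h\<^sub>j\<close>.
  The levels with sign \<open>+1\<close> (``flat'') force \<open>|h\<^sub>0| = |h\<^sub>1| = 1/2\<close> and \<open>|h\<^sub>2| + |h\<^sub>3| \<le> 1\<close>. At the levels with sign \<open>-1\<close>
  (``nodes'') a second order expansion in \<open>w = 1/A\<close> shows that one of the four values is at most
  \<open>(1 - 3w + (3 + 2\<kappa>)w\<^sup>2)/4 + O(w\<^sup>3)\<close> infinitely often, where \<open>B = A + \<kappa>\<close>. The bound is attained by the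
  periodic choice \<open>(h\<^sub>0, h\<^sub>1, h\<^sub>2, h\<^sub>3) = (1/2, 1/2, 0, 0)\<close> for \<open>\<kappa> = -1\<close> and \<open>(1/2, 1/2, 0, 1)\<close> for \<open>\<kappa> = 1\<close>.
\<close>

section \<open>The form at a single level\<close>

definition approx3 :: "real \<Rightarrow> real \<Rightarrow> real \<Rightarrow> real \<Rightarrow> real \<Rightarrow> real \<Rightarrow> bool" where
  "approx3 w K x c0 c1 c2 \<longleftrightarrow> \<bar>x - (c0 + c1 * w + c2 * w\<^sup>2)\<bar> \<le> K * w ^ 3"

lemma approx3_add:
  assumes "approx3 w K x x0 x1 x2" "approx3 w L y y0 y1 y2"
  shows "approx3 w (K + L) (x + y) (x0 + y0) (x1 + y1) (x2 + y2)"
  using assms unfolding approx3_def by (simp add: algebra_simps abs_le_iff)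

lemma approx3_weaken:
  assumes "approx3 w K x c0 c1 c2" "c0 = d0" "c1 = d1" "c2 = d2" "K \<le> L" "0 \<le> w"
  shows "approx3 w L x d0 d1 d2"
  using assms unfolding approx3_def by (meson mult_right_mono order_trans zero_le_power)

text \<open>With \<open>p\<close>, \<open>q\<close> the truncated polynomials, the error of
  \<open>x * y\<close> consists of the part of \<open>p * q\<close> of degree at least 3 and three
  terms containing \<open>x - p\<close> or \<open>y - q\<close>. Constants stay explicit because the
  final constant must not depend on \<open>R\<close>.\<close>

lemma approx3_mult:
  assumes w: "0 \<le> w" "w \<le> 1"
    and x: "approx3 w K x x0 x1 x2" and y: "approx3 w L y y0 y1 y2"
    and bx: "\<bar>x0\<bar> \<le> M" "\<bar>x1\<bar> \<le> M" "\<bar>x2\<bar> \<le> M"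
    and bY: "\<bar>y0\<bar> \<le> M" "\<bar>y1\<bar> \<le> M" "\<bar>y2\<bar> \<le> M"
    and K: "0 \<le> K" "0 \<le> L"
  shows "approx3 w (3 * M\<^sup>2 + 3 * M * L + 3 * M * K + K * L) (x * y)
           (x0 * y0) (x0 * y1 + x1 * y0) (x0 * y2 + x1 * y1 + x2 * y0)"
proof -
  define p q where "p = x0 + x1 * w + x2 * w\<^sup>2" and "q = y0 + y1 * w + y2 * w\<^sup>2"
  have M0: "0 \<le> M" using bx(1) by linarith
  have w2: "0 \<le> w\<^sup>2" "w\<^sup>2 \<le> 1" using w by (simp_all add: power_le_one)
  have w3: "0 \<le> w^3" "w^3 \<le> 1" using w by (simp_all add: power_le_one)
  have t: "\<bar>u * v\<bar> \<le> m" if "\<bar>u\<bar> \<le> m" "0 \<le> v" "v \<le> 1" for u v m :: real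
    using mult_mono[of "\<bar>u\<bar>" m "\<bar>v\<bar>" 1] that by (simp add: abs_mult)
  have p: "\<bar>p\<bar> \<le> 3 * M"
    using t[OF bx(2) w] t[OF bx(3) w2] bx(1) unfolding p_def by linarith
  have q: "\<bar>q\<bar> \<le> 3 * M"
    using t[OF bY(2) w] t[OF bY(3) w2] bY(1) unfolding q_def by linarith
  have X: "\<bar>x - p\<bar> \<le> K * w^3" and Y: "\<bar>y - q\<bar> \<le> L * w^3"
    using x y by (auto simp: approx3_def p_def q_def)
  have m: "\<bar>u * v\<bar> \<le> M\<^sup>2" if "\<bar>u\<bar> \<le> M" "\<bar>v\<bar> \<le> M" for u v
    using mult_mono[of "\<bar>u\<bar>" M "\<bar>v\<bar>" M] that M0 by (simp add: abs_mult power2_eq_square)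
  have "\<bar>x1 * y2 + x2 * y1 + x2 * y2 * w\<bar> \<le> 3 * M\<^sup>2"
    using m[OF bx(2) bY(3)] m[OF bx(3) bY(2)] t[OF m[OF bx(3) bY(3)] w] by linarith
  then have e1: "\<bar>(x1 * y2 + x2 * y1 + x2 * y2 * w) * w^3\<bar> \<le> 3 * M\<^sup>2 * w^3"
    using w3 by (simp add: abs_mult mult_right_mono)
  have e2: "\<bar>p * (y - q)\<bar> \<le> 3 * M * (L * w^3)"
    using mult_mono[OF p Y] M0 by (simp add: abs_mult)
  have e3: "\<bar>q * (x - p)\<bar> \<le> 3 * M * (K * w^3)"
    using mult_mono[OF q X] M0 by (simp add: abs_mult)
  have "\<bar>(x - p) * (y - q)\<bar> \<le> (K * w^3) * (L * w^3)"
    using mult_mono[OF X Y] K w3 by (simp add: abs_mult)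
  also have "\<dots> = (K * L * w^3) * w^3" by simp
  also have "\<dots> \<le> (K * L * w^3) * 1"
    using K w3 by (intro mult_left_mono) auto
  finally have e4: "\<bar>(x - p) * (y - q)\<bar> \<le> K * L * w^3" by simp
  have "x * y - (x0 * y0 + (x0 * y1 + x1 * y0) * w + (x0 * y2 + x1 * y1 + x2 * y0) * w\<^sup>2)
      = (x1 * y2 + x2 * y1 + x2 * y2 * w) * w^3 + p * (y - q) + q * (x - p) + (x - p) * (y - q)"
    unfolding p_def q_def by (simp add: algebra_simps power2_eq_square power3_eq_cube)
  then show ?thesis
    unfolding approx3_def using e1 e2 e3 e4 by (simp add: algebra_simps)
qed

text \<open>At a node, \<open>p\<close> and \<open>z\<close> are the shifts attached to partial quotients \<open>B\<close> and \<open>A\<close>, \<open>v\<close> and \<open>u\<close> their outer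
  neighbours in the sequence of shifts, and \<open>g\<close>, \<open>h\<close>, \<open>v1\<close>, \<open>h'\<close> the corresponding \<open>h\<^sub>j\<close> up to sign.\<close>

lemma node_coordinates:
  fixes w g h h' v1 b iB p z v u :: real
  assumes w: "0 < w" "w \<le> 1/1000"
    and c: "\<bar>g\<bar> \<le> 1" "\<bar>h\<bar> \<le> 1" "\<bar>h'\<bar> \<le> 1" "\<bar>v1\<bar> \<le> 1" "\<bar>b\<bar> \<le> 1"
    and iB: "\<bar>iB - (w - b * w\<^sup>2)\<bar> \<le> 2 * w^3"
    and p: "p = iB * (g - v - z)" and z: "z = w * (h + u - p)"
    and bnd: "\<bar>p\<bar> \<le> 5 * w" "\<bar>z\<bar> \<le> 5 * w"
    and u: "\<bar>u - h' * w\<bar> \<le> 30 * w\<^sup>2" and v: "\<bar>v - v1 * w\<bar> \<le> 30 * w\<^sup>2"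
  shows "approx3 w 60 p 0 g (- g * b - v1 - h)" "approx3 w 60 z 0 h (h' - g)"
proof -
  have w2: "0 \<le> w\<^sup>2" "w\<^sup>2 \<le> w / 1000" and w3: "0 \<le> w^3" "w^3 \<le> w\<^sup>2 / 1000"
    using w by (auto simp: power2_eq_square power3_eq_cube intro: mult_left_mono)
  have t: "\<bar>x * y\<bar> \<le> m * n" if "\<bar>x\<bar> \<le> m" "\<bar>y\<bar> \<le> n" for x y m n :: real
    using mult_mono[OF that] that by (simp add: abs_mult)
  have "\<bar>b * w\<^sup>2\<bar> \<le> 1 * w\<^sup>2" using c w2 by (intro t) auto
  then have iB1: "\<bar>iB - w\<bar> \<le> 2 * w\<^sup>2" using iB w3 w2 by linarith
  then have iB0: "\<bar>iB\<bar> \<le> 2 * w" using w2 w by linarith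
  have "\<bar>v1 * w\<bar> \<le> 1 * w" "\<bar>h' * w\<bar> \<le> 1 * w" using t[OF c(4), of w w] t[OF c(3), of w w] w by auto
  then have v0: "\<bar>v\<bar> \<le> 2 * w" and u0: "\<bar>u\<bar> \<le> 2 * w" using u v w2 by linarith+
  \<comment> \<open>Bootstrapping: the a priori O(w) bounds give \<open>z\<close> and
    \<open>p\<close> to first order here; substituting these once more into the two equations gives
    second order.\<close>
  have zh: "\<bar>z - h * w\<bar> \<le> 7 * w\<^sup>2"
  proof -
    have "\<bar>w * (u - p)\<bar> \<le> w * (7 * w)" using u0 bnd w by (intro t) auto
    then show ?thesis using z by (simp add: algebra_simps power2_eq_square)
  qed
  have vz: "\<bar>v + z\<bar> \<le> 7 * w" using v0 bnd by linarith
  have pg: "\<bar>p - g * w\<bar> \<le> 16 * w\<^sup>2"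
  proof -
    have "\<bar>(iB - w) * g\<bar> \<le> 2 * w\<^sup>2 * 1" using iB1 c by (intro t) auto
    moreover have "\<bar>iB * (v + z)\<bar> \<le> 2 * w * (7 * w)" using iB0 vz by (intro t) auto
    moreover have "p - g * w = (iB - w) * g - iB * (v + z)" using p by (simp add: algebra_simps)
    ultimately show ?thesis by (simp add: power2_eq_square)
  qed
  have "\<bar>w * ((u - h' * w) - (p - g * w))\<bar> \<le> w * (46 * w\<^sup>2)"
    using w u pg by (intro t) auto
  moreover have "z - (h * w + (h' - g) * w\<^sup>2) = w * ((u - h' * w) - (p - g * w))"
    by (subst z) (simp add: algebra_simps power2_eq_square)
  ultimately show "approx3 w 60 z 0 h (h' - g)"
    using w3 by (simp add: approx3_def power2_eq_square power3_eq_cube)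
  have "\<bar>g * (iB - (w - b * w\<^sup>2))\<bar> \<le> 1 * (2 * w^3)" using c iB by (intro t) auto
  moreover have "\<bar>(iB - w) * (v + z)\<bar> \<le> 2 * w\<^sup>2 * (7 * w)" using iB1 vz by (intro t) auto
  moreover have "\<bar>w * ((v - v1 * w) + (z - h * w))\<bar> \<le> w * (37 * w\<^sup>2)"
    using w v zh by (intro t) auto
  moreover have "p - (g * w + (- g * b - v1 - h) * w\<^sup>2)
     = g * (iB - (w - b * w\<^sup>2)) - (iB - w) * (v + z) - w * ((v - v1 * w) + (z - h * w))"
    by (subst p) (simp add: algebra_simps power2_eq_square)
  ultimately show "approx3 w 60 p 0 g (- g * b - v1 - h)"
    using w3 by (simp add: approx3_def power2_eq_square power3_eq_cube)
qed

text \<open>This expands the numerator of the form at a node. In each factor one second order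
  contribution cancels: \<open>h\<close> in \<open>p\<close> against \<open>\<beta> * z\<close>, and
  \<open>g\<close> in \<open>z\<close> against \<open>\<rho> * p\<close>.\<close>

lemma node_product:
  fixes w g h h' v1 b p z \<beta> \<rho> \<sigma> \<tau> :: real
  assumes w: "0 < w" "w \<le> 1/1000"
    and c: "\<bar>g\<bar> \<le> 1" "\<bar>h\<bar> \<le> 1" "\<bar>h'\<bar> \<le> 1" "\<bar>v1\<bar> \<le> 1" "\<bar>b\<bar> \<le> 1" "\<bar>\<sigma>\<bar> \<le> 1" "\<bar>\<tau>\<bar> \<le> 1"
    and p: "approx3 w 60 p 0 g (- g * b - v1 - h)" and z: "approx3 w 60 z 0 h (h' - g)"
    and \<beta>: "approx3 w 6 \<beta> 0 1 (- b)" and \<rho>: "approx3 w 6 \<rho> 0 1 0"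
  shows "approx3 w 100000000 ((\<sigma>/2 + p + \<beta> * (\<tau>/2 + z)) * (\<tau>/2 + z + \<rho> * (\<sigma>/2 + p)))
     (\<sigma>/2 * (\<tau>/2)) (\<sigma>/2 * (h + \<sigma>/2) + (g + \<tau>/2) * (\<tau>/2))
     (\<sigma>/2 * h' + (g + \<tau>/2) * (h + \<sigma>/2) + (- g * b - v1 - b * \<tau> / 2) * (\<tau>/2))"
proof -
  have gb: "\<bar>g * b\<bar> \<le> 1" "\<bar>b * \<tau>\<bar> \<le> 1"
    using mult_mono[of "\<bar>g\<bar>" 1 "\<bar>b\<bar>" 1] mult_mono[of "\<bar>b\<bar>" 1 "\<bar>\<tau>\<bar>" 1] c by (auto simp: abs_mult)
  have k: "approx3 w 0 x x 0 0" for x by (simp add: approx3_def)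
  note P = approx3_add[OF k[of "\<sigma>/2"] p] and Z = approx3_add[OF k[of "\<tau>/2"] z]
  have c': "g \<le> 1" "- g \<le> 1" "h \<le> 1" "- h \<le> 1" "h' \<le> 1" "- h' \<le> 1" "v1 \<le> 1" "- v1 \<le> 1"
    "b \<le> 1" "- b \<le> 1" "\<sigma> \<le> 1" "- \<sigma> \<le> 1" "\<tau> \<le> 1" "- \<tau> \<le> 1"
    "g * b \<le> 1" "- (g * b) \<le> 1" "b * \<tau> \<le> 1" "- (b * \<tau>) \<le> 1"
    using c gb by (simp_all only: abs_le_iff)
  have b: "\<bar>\<sigma>/2\<bar> \<le> 4" "\<bar>g + \<tau>/2\<bar> \<le> 4" "\<bar>- g * b - v1 - b * \<tau> / 2\<bar> \<le> 4"
    "\<bar>\<tau>/2\<bar> \<le> 4" "\<bar>h + \<sigma>/2\<bar> \<le> 4" "\<bar>h'\<bar> \<le> 4"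
    "\<bar>\<tau>/2 + 0\<bar> \<le> 4" "\<bar>0 + h\<bar> \<le> 4" "\<bar>0 + (h' - g)\<bar> \<le> 4"
    "\<bar>\<sigma>/2 + 0\<bar> \<le> 4" "\<bar>0 + g\<bar> \<le> 4" "\<bar>0 + (- g * b - v1 - h)\<bar> \<le> 4"
    "\<bar>0::real\<bar> \<le> 4" "\<bar>1::real\<bar> \<le> 4" "\<bar>- b\<bar> \<le> 4"
    using c' by - (rule abs_leI; linarith)+
  have w': "0 \<le> w" "w \<le> 1" using w by auto
  have "approx3 w 4000 (\<beta> * (\<tau>/2 + z)) 0 (\<tau>/2) (h - b * \<tau> / 2)"
    by (rule approx3_weaken[OF approx3_mult[OF w' \<beta> Z b(13,14,15) b(7,8,9)]]) (use w' in simp_all)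
  note U' = approx3_add[OF P this]
  have U: "approx3 w 5000 (\<sigma>/2 + p + \<beta> * (\<tau>/2 + z)) (\<sigma>/2) (g + \<tau>/2) (- g * b - v1 - b * \<tau> / 2)"
    by (rule approx3_weaken[OF U']) (use w' in simp_all)
  have "approx3 w 4000 (\<rho> * (\<sigma>/2 + p)) 0 (\<sigma>/2) g"
    by (rule approx3_weaken[OF approx3_mult[OF w' \<rho> P b(13,14,13) b(10,11,12)]]) (use w' in simp_all)
  note V' = approx3_add[OF Z this]
  have V: "approx3 w 5000 (\<tau>/2 + z + \<rho> * (\<sigma>/2 + p)) (\<tau>/2) (h + \<sigma>/2) h'"
    by (rule approx3_weaken[OF V']) (use w' in simp_all)
  show ?thesis
    by (rule approx3_weaken[OF approx3_mult[OF w' U V b(1-6)] refl refl refl _ w'(1)]) simp_all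
qed

text \<open>The divisor \<open>1 - d\<close> is the determinant of a node level, with
  \<open>d\<close> about w^2. Since the leading term is 1/4, dividing by it adds 1/4 to the second
  order coefficient, up to O(w^3).\<close>

lemma approx_div_upper:
  fixes w c1 c2 P d :: real
  assumes w: "0 < w" "w \<le> 1/100000" and c: "\<bar>c1\<bar> \<le> 3" "\<bar>c2\<bar> \<le> 3"
    and P: "P \<le> 1/4 + c1 * w + c2 * w\<^sup>2 + 100000000 * w^3"
    and d: "0 \<le> d" "d \<le> w\<^sup>2 + 20 * w^3"
  shows "P / (1 - d) \<le> 1/4 + c1 * w + (c2 + 1/4) * w\<^sup>2 + 1000000000 * w^3"
proof -
  have w2: "0 \<le> w\<^sup>2" "w\<^sup>2 \<le> w / 100000" and w3: "0 \<le> w^3" "w^3 \<le> w\<^sup>2 / 100000"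
    using w by (auto simp: power2_eq_square power3_eq_cube intro: mult_left_mono)
  have c1: "\<bar>c1 * w\<bar> \<le> 3 * w" "\<bar>c2 * w\<^sup>2\<bar> \<le> 3 * w\<^sup>2"
    using c w w2 by (auto simp: abs_mult mult_right_mono)
  have d1: "d < 1" using d w2 w3 w by linarith
  define N where "N = 1/4 + c1 * w + (c2 + 1/4) * w\<^sup>2 + 1000000000 * w^3"
  have N: "N \<le> 1/4 + 4 * w + 1000000000 * w^3"
    using c1 w w2 unfolding N_def by (simp add: distrib_right)
  have N0: "0 \<le> N" using c1 w w2 w3 unfolding N_def by (simp add: distrib_right)
  have "1000000000 * w^3 * (w\<^sup>2 + 20 * w^3) \<le> 1000000000 * w^3 * (2 / 10000000000)"
    using w w2 w3 by (intro mult_left_mono) auto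
  moreover have "(1/4 + 4 * w) * (w\<^sup>2 + 20 * w^3) \<le> w\<^sup>2 / 4 + 10 * w^3"
  proof -
    have "w * w^3 \<le> w^3 / 100000" using mult_right_mono[OF w(2) w3(1)] by simp
    then show ?thesis using w3 by (simp add: algebra_simps power2_eq_square power3_eq_cube)
  qed
  moreover have "N * d \<le> (1/4 + 4 * w + 1000000000 * w^3) * (w\<^sup>2 + 20 * w^3)"
    using N d N0 w w2 w3 by (intro mult_mono) auto
  moreover have "(1/4 + 4 * w + 1000000000 * w^3) * (w\<^sup>2 + 20 * w^3)
      = (1/4 + 4 * w) * (w\<^sup>2 + 20 * w^3) + 1000000000 * w^3 * (w\<^sup>2 + 20 * w^3)"
    by (simp only: distrib_right)
  ultimately have "N * d \<le> w\<^sup>2 / 4 + 900000000 * w^3"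
    using w3 by linarith
  then have "P \<le> N * (1 - d)"
    using P unfolding N_def right_diff_distrib mult_1_right by (simp add: distrib_right)
  then show ?thesis using d1 unfolding N_def[symmetric] by (simp add: pos_divide_le_eq)
qed

lemma approx_div_lower:
  fixes w c1 c2 P d :: real
  assumes w: "0 < w" "w \<le> 1/100000" and c: "\<bar>c1\<bar> \<le> 3" "\<bar>c2\<bar> \<le> 3"
    and P: "1/4 + c1 * w + c2 * w\<^sup>2 - 100000000 * w^3 \<le> P"
    and d: "w\<^sup>2 - 20 * w^3 \<le> d" "d < 1"
  shows "1/4 + c1 * w + (c2 + 1/4) * w\<^sup>2 - 1000000000 * w^3 \<le> P / (1 - d)"
proof -
  have w2: "0 \<le> w\<^sup>2" "w\<^sup>2 \<le> w / 100000" and w3: "0 \<le> w^3" "w^3 \<le> w\<^sup>2 / 100000"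
    using w by (auto simp: power2_eq_square power3_eq_cube intro: mult_left_mono)
  have c1: "\<bar>c1 * w\<bar> \<le> 3 * w" "\<bar>c2 * w\<^sup>2\<bar> \<le> 3 * w\<^sup>2"
    using c w w2 by (auto simp: abs_mult mult_right_mono)
  have P1: "1/4 - 4 * w \<le> P"
  proof -
    have "100000000 * w^3 \<le> w / 2" using w3 w2 by linarith
    then show ?thesis using P c1 w w2 by linarith
  qed
  have d0: "0 \<le> d" using d w2 w3 by linarith
  have "(1/4 - 4 * w) * (w\<^sup>2 - 20 * w^3) \<le> P * d"
    using P1 d w w2 w3 by (intro mult_mono) linarith+
  moreover have "(1/4 - 4 * w) * (w\<^sup>2 - 20 * w^3) = w\<^sup>2 / 4 - 9 * w^3 + 80 * (w * w^3)"
    by (simp add: algebra_simps power2_eq_square power3_eq_cube)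
  moreover have "0 \<le> w * w^3" using w w3 by simp
  ultimately have "P * (1 + d) \<ge> 1/4 + c1 * w + (c2 + 1/4) * w\<^sup>2 - 1000000000 * w^3"
    using P w3 by (simp add: algebra_simps)
  moreover have "P * (1 + d) \<le> P / (1 - d)"
  proof -
    have "P * ((1 + d) * (1 - d)) \<le> P * 1"
      using P1 w d0 by (intro mult_left_mono) (auto simp: algebra_simps)
    then show ?thesis using d by (simp add: pos_le_divide_eq mult.assoc)
  qed
  ultimately show ?thesis by linarith
qed

text \<open>The value \<open>|n| |n\<alpha> - \<gamma> - m|\<close> of the point with coordinates \<open>(x, y)\<close> in the basis of a level.\<close>

definition corner :: "real \<Rightarrow> real \<Rightarrow> real \<Rightarrow> real \<Rightarrow> real \<Rightarrow> real" where
  "corner e r \<beta> x y = \<bar>(x + \<beta> * y) * (y - e * r * x)\<bar> / (1 + e * r * \<beta>)"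

section \<open>Bounds for the four corner values of a level\<close>

lemma corner_swap: "corner (-1) r \<beta> x y = corner (-1) \<beta> r y x"
  by (simp add: corner_def mult.commute)

text \<open>Choose \<open>\<sigma>\<close> so that the first coordinate has absolute value 1/2 - |s|
  and add the inequalities for both \<open>\<tau>\<close>: the second factors sum to about 1
  whatever \<open>t\<close> is, so |s| is at most a multiple of \<open>w\<close>. Exchanging the
  coordinates handles \<open>t\<close>.\<close>

lemma level_bound:
  fixes w c r \<beta> e s t :: real
  assumes w: "0 < w" "w \<le> 1/100000" and r: "0 \<le> r" "r \<le> 11/10 * w" and \<beta>: "0 \<le> \<beta>" "\<beta> \<le> 11/10 * w"
    and e: "\<bar>e\<bar> = 1" and c: "c \<ge> 1/4 - 3/4 * w" and st: "\<bar>s\<bar> \<le> 1/2" "\<bar>t\<bar> \<le> 1/2"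
    and F: "\<And>\<sigma> \<tau>. \<sigma> \<in> {-1,1} \<Longrightarrow> \<tau> \<in> {-1,1} \<Longrightarrow>
      c \<le> corner e r \<beta> (\<sigma>/2 + s) (\<tau>/2 + t)"
  shows "\<bar>s\<bar> \<le> 5 * w" "\<bar>t\<bar> \<le> 5 * w"
proof -
  have w2: "0 \<le> w\<^sup>2" "w\<^sup>2 \<le> w / 100000"
    using w by (auto simp: power2_eq_square intro: mult_left_mono)
  have rb: "r * \<beta> \<le> (11/10 * w) * (11/10 * w)" "0 \<le> r * \<beta>"
    using mult_mono[OF r(2) \<beta>(2)] r \<beta> w by auto
  then have rb': "r * \<beta> \<le> 2 * w\<^sup>2" by (simp add: power2_eq_square)
  have e': "e = 1 \<or> e = -1" using e by linarith
  then have erb: "1 + e * r * \<beta> \<ge> 1 - 2 * w\<^sup>2" "1 + e * r * \<beta> > 0"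
    using rb' rb w2 w by auto
  have c0: "c \<ge> 0" using c w by simp
  have G: "(1/4 - 3/4 * w) * (1 - 2 * w\<^sup>2) \<le> (\<bar>\<sigma>/2 + s\<bar> + 11/10 * w) * (\<bar>\<tau>/2 + t\<bar> + 11/10 * w)"
    if st': "\<sigma> \<in> {-1,1}" "\<tau> \<in> {-1,1}" for \<sigma> \<tau>
  proof -
    define x y where "x = \<sigma>/2 + s" and "y = \<tau>/2 + t"
    have xy: "\<bar>x\<bar> \<le> 1" "\<bar>y\<bar> \<le> 1" using st' st unfolding x_def y_def by auto
    have "c * (1 + e * r * \<beta>) \<le> \<bar>(x + \<beta> * y) * (y - e * r * x)\<bar>"
      using F[OF st'] erb unfolding x_def y_def corner_def by (simp add: pos_le_divide_eq)
    moreover have "\<bar>x + \<beta> * y\<bar> \<le> \<bar>x\<bar> + 11/10 * w"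
    proof -
      have "\<bar>\<beta> * y\<bar> \<le> (11/10 * w) * 1"
        unfolding abs_mult using \<beta> xy w by (intro mult_mono) auto
      then show ?thesis by linarith
    qed
    moreover have "\<bar>y - e * r * x\<bar> \<le> \<bar>y\<bar> + 11/10 * w"
    proof -
      have "\<bar>(e * r) * x\<bar> \<le> (11/10 * w) * 1"
        unfolding abs_mult[of "e * r"] using r xy w e by (intro mult_mono) (auto simp: abs_mult)
      then show ?thesis by linarith
    qed
    ultimately have "c * (1 + e * r * \<beta>) \<le> (\<bar>x\<bar> + 11/10 * w) * (\<bar>y\<bar> + 11/10 * w)"
      unfolding abs_mult using w by (meson abs_ge_zero add_nonneg_nonneg mult_mono order_trans)
    moreover have "(1/4 - 3/4 * w) * (1 - 2 * w\<^sup>2) \<le> c * (1 + e * r * \<beta>)"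
      using c c0 erb w w2 by (intro mult_mono) auto
    ultimately show ?thesis unfolding x_def y_def by linarith
  qed
  have key: "\<bar>u\<bar> \<le> 5 * w" if u: "\<bar>u\<bar> \<le> 1/2" and v: "\<bar>v\<bar> \<le> 1/2"
    and H: "\<And>\<sigma> \<tau>. \<sigma> \<in> {-1,1} \<Longrightarrow> \<tau> \<in> {-1,1} \<Longrightarrow>
      (1/4 - 3/4 * w) * (1 - 2 * w\<^sup>2) \<le> (\<bar>\<sigma>/2 + u\<bar> + 11/10 * w) * (\<bar>\<tau>/2 + v\<bar> + 11/10 * w)" for u v
  proof -
    define \<sigma> :: real where "\<sigma> = (if u \<ge> 0 then -1 else 1)"
    have \<sigma>: "\<sigma> \<in> {-1,1}" "\<bar>\<sigma>/2 + u\<bar> = 1/2 - \<bar>u\<bar>" using u unfolding \<sigma>_def by auto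
    have "(1/2 - 3/2 * w) * (1 - 2 * w\<^sup>2) \<le> (1/2 - \<bar>u\<bar> + 11/10 * w) * (1 + 22/10 * w)"
    proof -
      have v1: "\<bar>1/2 + v\<bar> = 1/2 + v" "\<bar>-1/2 + v\<bar> = 1/2 - v" using v by auto
      define m where "m = 1/2 - \<bar>u\<bar> + 11/10 * w"
      have "(1/4 - 3/4 * w) * (1 - 2 * w\<^sup>2) \<le> m * (1/2 + v + 11/10 * w)"
        "(1/4 - 3/4 * w) * (1 - 2 * w\<^sup>2) \<le> m * (1/2 - v + 11/10 * w)"
        using H[OF \<sigma>(1), of 1] H[OF \<sigma>(1), of "-1"] unfolding \<sigma>(2) v1 m_def by simp_all
      then have "2 * ((1/4 - 3/4 * w) * (1 - 2 * w\<^sup>2)) \<le> m * (1/2 + v + 11/10 * w) + m * (1/2 - v + 11/10 * w)"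
        by linarith
      also have "\<dots> = m * (1 + 22/10 * w)" by (simp add: algebra_simps)
      also have "2 * ((1/4 - 3/4 * w) * (1 - 2 * w\<^sup>2)) = (1/2 - 3/2 * w) * (1 - 2 * w\<^sup>2)"
        by (simp add: algebra_simps)
      finally show ?thesis unfolding m_def[symmetric] .
    qed
    moreover have "(1/2 - 3/2 * w) * (1 - 2 * w\<^sup>2) \<ge> 1/2 - 3/2 * w - w\<^sup>2"
      using w w2 by (simp add: algebra_simps)
    moreover have "(1/2 - \<bar>u\<bar> + 11/10 * w) * (1 + 22/10 * w) \<le> 1/2 - \<bar>u\<bar> + 22/10 * w + 3 * w\<^sup>2"
      using w w2 mult_nonneg_nonneg[of "\<bar>u\<bar>" w] by (simp add: algebra_simps power2_eq_square)
    ultimately show ?thesis using w w2 by linarith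
  qed
  show "\<bar>s\<bar> \<le> 5 * w" by (rule key[OF st G])
  show "\<bar>t\<bar> \<le> 5 * w" by (rule key[OF st(2,1)]) (metis G mult.commute)
qed

text \<open>The first order terms \<open>\<beta> * y\<^sup>2 - r * x\<^sup>2\<close> cancel, because
  \<open>\<beta>\<close> and \<open>r\<close> agree up to second order and |x|, |y| differ by
  O(w).\<close>

lemma flat_product:
  fixes w r \<beta> x y :: real
  assumes w: "0 < w" and r: "0 \<le> r" "r \<le> 2 * w" and \<beta>: "0 \<le> \<beta>" "\<beta> \<le> 2 * w" "\<bar>\<beta> - r\<bar> \<le> w\<^sup>2"
    and xy: "\<bar>x\<bar> \<le> 1" "\<bar>y\<bar> \<le> 1" "\<bar>\<bar>y\<bar> - \<bar>x\<bar>\<bar> \<le> 10 * w"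
  shows "\<bar>(x + \<beta> * y) * (y - r * x) - x * y\<bar> \<le> 45 * w\<^sup>2"
proof -
  have sq: "y\<^sup>2 \<le> 1" using xy by (simp add: abs_le_square_iff[of y 1, simplified])
  have "\<bar>(\<beta> - r) * y\<^sup>2\<bar> \<le> w\<^sup>2 * 1" unfolding abs_mult using \<beta> sq by (intro mult_mono) auto
  moreover have "\<bar>r * ((\<bar>y\<bar> - \<bar>x\<bar>) * (\<bar>y\<bar> + \<bar>x\<bar>))\<bar> \<le> (2 * w) * ((10 * w) * 2)"
    unfolding abs_mult using r xy w by (intro mult_mono) auto
  moreover have "(\<bar>y\<bar> - \<bar>x\<bar>) * (\<bar>y\<bar> + \<bar>x\<bar>) = y\<^sup>2 - x\<^sup>2"
    by (simp add: algebra_simps power2_eq_square)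
  moreover have "\<bar>r * \<beta> * (x * y)\<bar> \<le> (2 * w * (2 * w)) * (1 * 1)"
    unfolding abs_mult using r \<beta> w xy by (intro mult_mono) auto
  moreover have "(x + \<beta> * y) * (y - r * x) - x * y
     = (\<beta> - r) * y\<^sup>2 + r * (y\<^sup>2 - x\<^sup>2) - r * \<beta> * (x * y)"
    by (simp add: algebra_simps power2_eq_square)
  ultimately show ?thesis by (simp add: power2_eq_square)
qed

text \<open>The binding corner is the one shrunk in both coordinates, where the form is (1/2 -
  |s|)(1/2 - |t|) up to O(w^2).\<close>

lemma flat_upper:
  fixes w r \<beta> s t c :: real
  assumes w: "0 < w" "w \<le> 1/100000" and r: "0 \<le> r" "r \<le> 2 * w" and \<beta>: "0 \<le> \<beta>" "\<beta> \<le> 2 * w" "\<bar>\<beta> - r\<bar> \<le> w\<^sup>2"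
    and st: "\<bar>s\<bar> \<le> 5 * w" "\<bar>t\<bar> \<le> 5 * w" and c: "c \<ge> 1/4 - 3/4 * w"
    and F: "\<And>\<sigma> \<tau>. \<sigma> \<in> {-1,1} \<Longrightarrow> \<tau> \<in> {-1,1} \<Longrightarrow>
      c \<le> corner 1 r \<beta> (\<sigma>/2 + s) (\<tau>/2 + t)"
  shows "\<bar>s\<bar> + \<bar>t\<bar> \<le> 3/2 * w + 200 * w\<^sup>2"
proof -
  define \<sigma> :: real where "\<sigma> = (if s \<ge> 0 then -1 else 1)"
  define \<tau> :: real where "\<tau> = (if t \<ge> 0 then -1 else 1)"
  define x y where "x = \<sigma>/2 + s" and "y = \<tau>/2 + t"
  have x: "\<bar>x\<bar> = 1/2 - \<bar>s\<bar>" and y: "\<bar>y\<bar> = 1/2 - \<bar>t\<bar>"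
    using st w unfolding \<sigma>_def \<tau>_def x_def y_def by auto
  have "c \<le> \<bar>(x + \<beta> * y) * (y - r * x)\<bar> / (1 + r * \<beta>)"
    using F[of \<sigma> \<tau>] unfolding x_def y_def corner_def mult_1_left by (auto simp: \<sigma>_def \<tau>_def)
  also have "\<dots> \<le> \<bar>(x + \<beta> * y) * (y - r * x)\<bar> / 1"
    using mult_nonneg_nonneg[OF r(1) \<beta>(1)] by (intro divide_left_mono) auto
  also have "\<dots> \<le> \<bar>x * y\<bar> + 45 * w\<^sup>2"
  proof -
    have "\<bar>(x + \<beta> * y) * (y - r * x) - x * y\<bar> \<le> 45 * w\<^sup>2"
      by (rule flat_product[OF w(1) r \<beta>]) (use x y st w in \<open>auto intro!: abs_leI\<close>)
    then show ?thesis unfolding div_by_1 by linarith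
  qed
  also have "\<bar>x * y\<bar> = 1/4 - \<bar>s\<bar> / 2 - \<bar>t\<bar> / 2 + \<bar>s\<bar> * \<bar>t\<bar>"
    unfolding abs_mult x y by (simp add: algebra_simps)
  also have "\<bar>s\<bar> * \<bar>t\<bar> \<le> (5 * w) * (5 * w)" using st w by (intro mult_mono) auto
  finally have "c \<le> 1/4 - \<bar>s\<bar> / 2 - \<bar>t\<bar> / 2 + (5 * w) * (5 * w) + 45 * w\<^sup>2" by simp
  moreover have "(5 * w) * (5 * w) = 25 * w\<^sup>2" "0 \<le> w\<^sup>2" by (simp_all add: power2_eq_square)
  ultimately show ?thesis using c by linarith
qed

text \<open>Compared with the critical value 3/2 w of |s| + |t|, the bound 5/4 w leaves a first
  order margin w/8, which absorbs every second order term. The coefficient 5/4 of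
  \<open>w\<^sup>2\<close> is the larger value of \<open>(3 + 2 * \<kappa>) / 4\<close>.\<close>

lemma flat_lower:
  fixes w r \<beta> s t \<sigma> \<tau> :: real
  assumes w: "0 < w" "w \<le> 1/100000" and r: "0 \<le> r" "r \<le> 2 * w" and \<beta>: "0 \<le> \<beta>" "\<beta> \<le> 2 * w" "\<bar>\<beta> - r\<bar> \<le> w\<^sup>2"
    and st: "\<bar>s\<bar> + \<bar>t\<bar> \<le> 5/4 * w" and \<sigma>: "\<sigma> \<in> {-1,1}" "\<tau> \<in> {-1,1}"
  shows "1/4 - 3/4 * w + 5/4 * w\<^sup>2 \<le> corner 1 r \<beta> (\<sigma>/2 + s) (\<tau>/2 + t)"
proof -
  define x y where "x = \<sigma>/2 + s" and "y = \<tau>/2 + t"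
  have w2: "0 \<le> w\<^sup>2" "w\<^sup>2 \<le> w / 100000"
    using w by (auto simp: power2_eq_square intro: mult_left_mono)
  have x: "1/2 - \<bar>s\<bar> \<le> \<bar>x\<bar>" "\<bar>x\<bar> \<le> 1/2 + \<bar>s\<bar>" and y: "1/2 - \<bar>t\<bar> \<le> \<bar>y\<bar>" "\<bar>y\<bar> \<le> 1/2 + \<bar>t\<bar>"
    using \<sigma> unfolding x_def y_def by auto
  have rb: "0 \<le> r * \<beta>" "r * \<beta> \<le> (2 * w) * (2 * w)"
    using mult_mono[OF r(2) \<beta>(2)] r \<beta> w by auto
  have "(1/2 - \<bar>s\<bar>) * (1/2 - \<bar>t\<bar>) \<le> \<bar>x * y\<bar>"
    unfolding abs_mult using x y st w by (intro mult_mono) auto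
  moreover have "(1/2 - \<bar>s\<bar>) * (1/2 - \<bar>t\<bar>) = 1/4 - \<bar>s\<bar> / 2 - \<bar>t\<bar> / 2 + \<bar>s\<bar> * \<bar>t\<bar>"
    by (simp add: algebra_simps)
  moreover have "1/4 - 5/8 * w \<le> 1/4 - \<bar>s\<bar> / 2 - \<bar>t\<bar> / 2 + \<bar>s\<bar> * \<bar>t\<bar>"
    using st by (simp add: add_increasing2)
  ultimately have "1/4 - 5/8 * w \<le> \<bar>x * y\<bar>" by (simp only:)
  moreover have "\<bar>(x + \<beta> * y) * (y - r * x) - x * y\<bar> \<le> 45 * w\<^sup>2"
  proof (rule flat_product[OF w(1) r \<beta>])
    have "\<bar>s\<bar> \<le> 5/4 * w" "\<bar>t\<bar> \<le> 5/4 * w"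
      using st by auto
    then show "\<bar>x\<bar> \<le> 1" "\<bar>y\<bar> \<le> 1" "\<bar>\<bar>y\<bar> - \<bar>x\<bar>\<bar> \<le> 10 * w"
      using x y w by (auto intro!: abs_leI)
  qed
  ultimately have "1/4 - 5/8 * w - 45 * w\<^sup>2 \<le> \<bar>(x + \<beta> * y) * (y - r * x)\<bar>" by linarith
  moreover have "(1/4 - 3/4 * w + 5/4 * w\<^sup>2) * (1 + r * \<beta>) \<le> 1/4 - 3/4 * w + 5/4 * w\<^sup>2 + 4 * w\<^sup>2"
  proof -
    have "(1/4 - 3/4 * w + 5/4 * w\<^sup>2) * (r * \<beta>) \<le> 1 * (2 * w * (2 * w))"
      using rb w w2 by (intro mult_mono[OF _ rb(2)]) auto
    also have "1 * (2 * w * (2 * w)) = 4 * w\<^sup>2" by (simp add: power2_eq_square)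
    finally show ?thesis unfolding distrib_left mult_1_right by linarith
  qed
  ultimately have "(1/4 - 3/4 * w + 5/4 * w\<^sup>2) * (1 + r * \<beta>) \<le> \<bar>(x + \<beta> * y) * (y - r * x)\<bar>"
    using w w2 by linarith
  then show ?thesis using rb unfolding x_def y_def corner_def by (simp add: pos_le_divide_eq)
qed

lemma node_determinant:
  fixes w b \<beta> \<rho> :: real
  assumes w: "0 < w" "w \<le> 1/100000" and b: "\<bar>b\<bar> \<le> 1"
    and \<beta>: "approx3 w 6 \<beta> 0 1 (- b)" and \<rho>: "approx3 w 6 \<rho> 0 1 0"
  shows "0 \<le> \<rho> * \<beta>" "w\<^sup>2 - 20 * w^3 \<le> \<rho> * \<beta>" "\<rho> * \<beta> \<le> w\<^sup>2 + 20 * w^3" "\<rho> * \<beta> < 1"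
proof -
  have w2: "0 \<le> w\<^sup>2" "w\<^sup>2 \<le> w / 100000" and w3: "0 \<le> w^3" "w^3 \<le> w\<^sup>2 / 100000"
    using w by (auto simp: power2_eq_square power3_eq_cube intro: mult_left_mono)
  have bw: "\<bar>b * w\<^sup>2\<bar> \<le> 1 * w\<^sup>2" unfolding abs_mult using b w2 by (intro mult_mono) auto
  have r: "w - w\<^sup>2 \<le> \<rho>" "\<rho> \<le> w + w\<^sup>2" using \<rho> w2 w3 unfolding approx3_def by auto
  have be: "w - 2 * w\<^sup>2 \<le> \<beta>" "\<beta> \<le> w + 2 * w\<^sup>2" using \<beta> w2 w3 bw unfolding approx3_def by auto
  have w4: "0 \<le> w\<^sup>2 * w\<^sup>2" "w\<^sup>2 * w\<^sup>2 \<le> w^3"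
    using mult_left_mono[of w 1 "w^3"] w w3 by (auto simp: power2_eq_square power3_eq_cube mult.assoc)
  have "(w - w\<^sup>2) * (w - 2 * w\<^sup>2) \<le> \<rho> * \<beta>"
    using r be w w2 by (intro mult_mono) auto
  moreover have "(w - w\<^sup>2) * (w - 2 * w\<^sup>2) = w\<^sup>2 - 3 * w^3 + 2 * (w\<^sup>2 * w\<^sup>2)"
    by (simp add: algebra_simps power2_eq_square power3_eq_cube)
  ultimately show l: "w\<^sup>2 - 20 * w^3 \<le> \<rho> * \<beta>" using w3 w4 by linarith
  have "\<rho> * \<beta> \<le> (w + w\<^sup>2) * (w + 2 * w\<^sup>2)"
    using r be w w2 by (intro mult_mono) auto
  moreover have "(w + w\<^sup>2) * (w + 2 * w\<^sup>2) = w\<^sup>2 + 3 * w^3 + 2 * (w\<^sup>2 * w\<^sup>2)"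
    by (simp add: algebra_simps power2_eq_square power3_eq_cube)
  ultimately show u: "\<rho> * \<beta> \<le> w\<^sup>2 + 20 * w^3" using w3 w4 by linarith
  show "0 \<le> \<rho> * \<beta>" "\<rho> * \<beta> < 1" using l u w w2 w3 by linarith+
qed

text \<open>Multiplying by \<open>\<sigma> * \<tau>\<close> removes the absolute value, since the
  numerator has leading term \<open>\<sigma> * \<tau> / 4\<close>. The extra 1/4 in second order
  comes from the determinant \<open>1 - \<rho> * \<beta>\<close>.\<close>

lemma node_corner:
  fixes w g h h' v1 b p z \<beta> \<rho> \<sigma> \<tau> k1 k2 :: real
  assumes w: "0 < w" "w \<le> 1/100000"
    and c: "\<bar>g\<bar> \<le> 1" "\<bar>h\<bar> \<le> 1" "\<bar>h'\<bar> \<le> 1" "\<bar>v1\<bar> \<le> 1" "\<bar>b\<bar> \<le> 1"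
    and p: "approx3 w 60 p 0 g (- g * b - v1 - h)" and z: "approx3 w 60 z 0 h (h' - g)"
    and \<beta>: "approx3 w 6 \<beta> 0 1 (- b)" and \<rho>: "approx3 w 6 \<rho> 0 1 0"
    and s: "\<sigma> \<in> {-1,1}" "\<tau> \<in> {-1,1}"
    and k: "k1 = \<sigma> * \<tau> * (\<sigma>/2 * (h + \<sigma>/2) + (g + \<tau>/2) * (\<tau>/2))"
      "k2 = \<sigma> * \<tau> * (\<sigma>/2 * h' + (g + \<tau>/2) * (h + \<sigma>/2) + (- g * b - v1 - b * \<tau> / 2) * (\<tau>/2))"
    and kb: "\<bar>k1\<bar> \<le> 3" "\<bar>k2\<bar> \<le> 3"
  shows "\<bar>corner (-1) \<rho> \<beta> (\<sigma>/2 + p) (\<tau>/2 + z) - (1/4 + k1 * w + (k2 + 1/4) * w\<^sup>2)\<bar> \<le> 1000000000 * w^3"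
proof -
  have w2: "0 \<le> w\<^sup>2" "w\<^sup>2 \<le> w / 100000" and w3: "0 \<le> w^3" "w^3 \<le> w\<^sup>2 / 100000"
    using w by (auto simp: power2_eq_square power3_eq_cube intro: mult_left_mono)
  define U where "U = (\<sigma>/2 + p + \<beta> * (\<tau>/2 + z)) * (\<tau>/2 + z + \<rho> * (\<sigma>/2 + p))"
  define c1 where "c1 = \<sigma>/2 * (h + \<sigma>/2) + (g + \<tau>/2) * (\<tau>/2)"
  define c2 where "c2 = \<sigma>/2 * h' + (g + \<tau>/2) * (h + \<sigma>/2) + (- g * b - v1 - b * \<tau> / 2) * (\<tau>/2)"
  have "approx3 w 100000000 U (\<sigma>/2 * (\<tau>/2)) c1 c2"
    unfolding U_def c1_def c2_def
    by (rule node_product[where h' = h', OF _ _ c _ _ p z \<beta> \<rho>]) (use w s in auto)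
  then have "\<bar>U - (\<sigma> * \<tau> / 4 + c1 * w + c2 * w\<^sup>2)\<bar> \<le> 100000000 * w^3"
    by (simp add: approx3_def)
  moreover have st: "\<sigma> * \<tau> = 1 \<or> \<sigma> * \<tau> = -1" using s by auto
  ultimately have V: "\<bar>\<sigma> * \<tau> * U - (1/4 + k1 * w + k2 * w\<^sup>2)\<bar> \<le> 100000000 * w^3"
    unfolding k c1_def[symmetric] c2_def[symmetric] by (elim disjE; simp; linarith)
  have kw: "\<bar>k1 * w\<bar> \<le> 3 * w" "\<bar>k2 * w\<^sup>2\<bar> \<le> 3 * w\<^sup>2"
    using kb w w2 by (auto simp: abs_mult mult_right_mono)
  have "0 \<le> \<sigma> * \<tau> * U" using V kw w w2 w3 by linarith
  then have aU: "\<bar>U\<bar> = \<sigma> * \<tau> * U" using st by auto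
  have co: "corner (-1) \<rho> \<beta> (\<sigma>/2 + p) (\<tau>/2 + z) = \<bar>U\<bar> / (1 - \<rho> * \<beta>)"
    by (simp add: corner_def U_def)
  note d = node_determinant[OF w c(5) \<beta> \<rho>]
  have "\<bar>U\<bar> / (1 - \<rho> * \<beta>) \<le> 1/4 + k1 * w + (k2 + 1/4) * w\<^sup>2 + 1000000000 * w^3"
    by (rule approx_div_upper[OF w kb _ d(1,3)]) (use V aU in linarith)
  moreover have "1/4 + k1 * w + (k2 + 1/4) * w\<^sup>2 - 1000000000 * w^3 \<le> \<bar>U\<bar> / (1 - \<rho> * \<beta>)"
    by (rule approx_div_lower[OF w kb _ d(2,4)]) (use V aU in linarith)
  ultimately show ?thesis unfolding co by linarith
qed

text \<open>One corner with \<open>\<tau> = - \<sigma>\<close> suffices. Its first order coefficient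
  is -5/4, which is already too small, or -3/4, and then the second order decides. When
  \<open>g = 0\<close>, having \<open>h' = - h\<close> instead would raise the second order
  coefficient of this corner by 1/2, above the bound for \<open>b = -1\<close>.\<close>

lemma node_upper:
  fixes w g h h' b p z \<beta> \<rho> c :: real
  assumes w: "0 < w" "w \<le> 1/100000"
    and h: "h \<in> {-1/2, 1/2}" "h' \<in> {-1/2, 1/2}" and g: "g \<in> {-1, 1} \<or> g = 0 \<and> h' = h" and b: "b \<in> {-1,1}"
    and p: "approx3 w 60 p 0 g (- g * b - h)" and z: "approx3 w 60 z 0 h (h' - g)"
    and \<beta>: "approx3 w 6 \<beta> 0 1 (- b)" and \<rho>: "approx3 w 6 \<rho> 0 1 0"
    and F: "\<And>\<sigma> \<tau>. \<sigma> \<in> {-1,1} \<Longrightarrow> \<tau> \<in> {-1,1} \<Longrightarrow> c \<le> corner (-1) \<rho> \<beta> (\<sigma>/2 + p) (\<tau>/2 + z)"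
  shows "c \<le> 1/4 - 3/4 * w + (3 + 2 * b) / 4 * w\<^sup>2 + 1000000000 * w^3"
proof -
  have w2: "0 \<le> w\<^sup>2" "w\<^sup>2 \<le> w / 100000" and w3: "0 \<le> w^3"
    using w by (auto simp: power2_eq_square intro: mult_left_mono)
  define \<sigma> where "\<sigma> = (if g = 0 then 2 * h else - g)"
  define k1 where "k1 = \<sigma> * (-\<sigma>) * (\<sigma>/2 * (h + \<sigma>/2) + (g + (-\<sigma>)/2) * ((-\<sigma>)/2))"
  define k2 where "k2 = \<sigma> * (-\<sigma>) * (\<sigma>/2 * h' + (g + (-\<sigma>)/2) * (h + \<sigma>/2) + (- g * b - 0 - b * (-\<sigma>) / 2) * ((-\<sigma>)/2))"
  have \<sigma>: "\<sigma> \<in> {-1,1}" "-\<sigma> \<in> {-1,1}" using h g unfolding \<sigma>_def insert_iff empty_iff by (safe; simp)+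
  have k: "\<bar>k1\<bar> \<le> 3" "\<bar>k2\<bar> \<le> 3" "k1 = -3/4 \<and> k2 + 1/4 \<le> (3 + 2 * b) / 4 \<or> k1 = -5/4"
    using h g b unfolding k1_def k2_def \<sigma>_def insert_iff empty_iff by (safe; simp)+
  have "\<bar>corner (-1) \<rho> \<beta> (\<sigma>/2 + p) ((-\<sigma>)/2 + z) - (1/4 + k1 * w + (k2 + 1/4) * w\<^sup>2)\<bar> \<le> 1000000000 * w^3"
    by (rule node_corner[where g = g and h = h and h' = h' and ?v1.0 = 0 and b = b, OF w])
       (use h g b p z \<beta> \<rho> \<sigma> k in \<open>auto simp: k1_def k2_def\<close>)
  then have c: "c \<le> 1/4 + k1 * w + (k2 + 1/4) * w\<^sup>2 + 1000000000 * w^3"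
    using F[OF \<sigma>] by linarith
  show ?thesis
  proof (cases "k1 = -5/4")
    case True
    have "(k2 + 1/4) * w\<^sup>2 \<le> 4 * w\<^sup>2" using k w2 by (intro mult_right_mono) auto
    moreover have "0 \<le> (3 + 2 * b) / 4 * w\<^sup>2" using b w2 by auto
    moreover have "c \<le> 1/4 - 3/4 * w + Y + 1000000000 * w^3"
      if "X \<le> 4 * w\<^sup>2" "0 \<le> Y" "c \<le> 1/4 + (-5/4) * w + X + 1000000000 * w^3" for X Y
      using that w w2 by linarith
    ultimately show ?thesis using c unfolding True by blast
  next
    case False
    then have "(k2 + 1/4) * w\<^sup>2 \<le> (3 + 2 * b) / 4 * w\<^sup>2" "k1 = -3/4"
      using k w2 by (intro mult_right_mono, auto)
    then show ?thesis using c by simp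
  qed
qed

text \<open>The four tuples are the two nodes of the extremal grid for \<kappa> = -1, followed by
  the two for \<kappa> = 1. Each of their corners has first order coefficient -3/4 and a sufficient
  second order one, or first order coefficient at least -5/8.\<close>

lemma node_lower:
  fixes w g h h' v1 b p z \<beta> \<rho> \<sigma> \<tau> :: real
  assumes w: "0 < w" "w \<le> 1/100000"
    and d: "(b, h, h', g, v1) \<in> {(-1, 1/2, 1/2, 0, 0), (-1, 1/2, -1/2, 0, 0), (1, 1/2, 1/2, 1, 0), (1, 1/2, -1/2, 0, -1)}"
    and p: "approx3 w 60 p 0 g (- g * b - v1 - h)" and z: "approx3 w 60 z 0 h (h' - g)"
    and \<beta>: "approx3 w 6 \<beta> 0 1 (- b)" and \<rho>: "approx3 w 6 \<rho> 0 1 0"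
    and s: "\<sigma> \<in> {-1,1}" "\<tau> \<in> {-1,1}"
  shows "1/4 - 3/4 * w + (3 + 2 * b) / 4 * w\<^sup>2 - 1000000000 * w^3 \<le> corner (-1) \<rho> \<beta> (\<sigma>/2 + p) (\<tau>/2 + z)"
proof -
  have w2: "0 \<le> w\<^sup>2" "w\<^sup>2 \<le> w / 100000" and w3: "0 \<le> w^3"
    using w by (auto simp: power2_eq_square intro: mult_left_mono)
  define k1 where "k1 = \<sigma> * \<tau> * (\<sigma>/2 * (h + \<sigma>/2) + (g + \<tau>/2) * (\<tau>/2))"
  define k2 where "k2 = \<sigma> * \<tau> * (\<sigma>/2 * h' + (g + \<tau>/2) * (h + \<sigma>/2) + (- g * b - v1 - b * \<tau> / 2) * (\<tau>/2))"
  have k: "\<bar>k1\<bar> \<le> 3" "\<bar>k2\<bar> \<le> 3" "k1 = -3/4 \<and> k2 + 1/4 \<ge> (3 + 2 * b) / 4 \<or> k1 \<ge> -5/8"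
    using d s unfolding k1_def k2_def insert_iff empty_iff prod.inject by (safe; simp)+
  have l: "\<bar>corner (-1) \<rho> \<beta> (\<sigma>/2 + p) (\<tau>/2 + z) - (1/4 + k1 * w + (k2 + 1/4) * w\<^sup>2)\<bar> \<le> 1000000000 * w^3"
    by (rule node_corner[where g = g and h = h and h' = h' and ?v1.0 = v1 and b = b, OF w])
       (use d p z \<beta> \<rho> s k in \<open>auto simp: k1_def k2_def\<close>)
  have "1/4 - 3/4 * w + (3 + 2 * b) / 4 * w\<^sup>2 \<le> 1/4 + k1 * w + (k2 + 1/4) * w\<^sup>2"
  proof (cases "k1 \<ge> -5/8")
    case True
    have "(k2 + 1/4) * w\<^sup>2 \<ge> (-4) * w\<^sup>2" using k w2 by (intro mult_right_mono) auto
    moreover have "k1 * w \<ge> (-5/8) * w" using True w by (intro mult_right_mono) auto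
    moreover have "5 * w\<^sup>2 \<ge> (3 + 2 * b) / 4 * w\<^sup>2" using d w2 by (intro mult_right_mono) auto
    moreover have "1/4 - 3/4 * w + Y \<le> 1/4 + K + X"
      if "X \<ge> (-4) * w\<^sup>2" "K \<ge> (-5/8) * w" "5 * w\<^sup>2 \<ge> Y" for X Y K
      using that w w2 by linarith
    ultimately show ?thesis by blast
  next
    case False
    then have "(k2 + 1/4) * w\<^sup>2 \<ge> (3 + 2 * b) / 4 * w\<^sup>2" "k1 = -3/4"
      using k w2 by (intro mult_right_mono, auto)
    then show ?thesis by simp
  qed
  then show ?thesis using l by linarith
qed

section \<open>Coordinates with respect to the convergents\<close>

lemma dist_nint_le: "dist_nint x \<le> \<bar>x - of_int m\<bar>"
  unfolding dist_nint_def by (metis round_diff_minimal)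

lemma dist_nint_nonneg: "0 \<le> dist_nint x"
  by (simp add: dist_nint_def)

lemma dist_nint_pos: "x \<notin> \<int> \<Longrightarrow> 0 < dist_nint x"
  by (auto simp: dist_nint_def) (metis Ints_of_int)

lemma dist_nint_cases:
  obtains "dist_nint x = frac x" | "dist_nint x \<noteq> frac x" "x \<notin> \<int>" "dist_nint x = 1 - frac x"
proof (cases "dist_nint x = frac x")
  case False
  have "x \<notin> \<int>"
  proof
    assume "x \<in> \<int>"
    then have "dist_nint x = 0" "frac x = 0" by (auto simp: dist_nint_def elim: Ints_cases)
    then show False using False by simp
  qed
  moreover have "dist_nint x = 1 - frac x"
    using False calculation unfolding dist_nint_def round_altdef frac_def
    by (auto simp: ceiling_altdef split: if_splits)
  ultimately show ?thesis using that False by blast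
qed

text \<open>The two smallest absolute values of such numbers are 1/2 and 3/2, and already 1/2 + 3/2
  = 2 is excluded.\<close>

lemma half_odd_pair:
  fixes x y :: real
  assumes "x - 1/2 \<in> \<int>" "y - 1/2 \<in> \<int>" "\<bar>x\<bar> + \<bar>y\<bar> < 2"
  shows "x \<in> {-1/2, 1/2}" "y \<in> {-1/2, 1/2}"
proof -
  obtain i j :: int where "x = of_int i + 1/2" "y = of_int j + 1/2"
    using assms(1,2) by (metis Ints_cases diff_add_cancel)
  moreover have "\<bar>of_int n + 1/2\<bar> \<ge> (1/2::real)" for n :: int
  proof -
    have "n \<ge> 0 \<or> n \<le> -1" by linarith
    then have "real_of_int n \<ge> 0 \<or> real_of_int n \<le> -1" by linarith
    then show ?thesis by linarith
  qed
  note this[of i] this[of j]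
  ultimately have "\<bar>of_int i + 1/2\<bar> < (3/2::real)" "\<bar>of_int j + 1/2\<bar> < (3/2::real)" using assms(3) by auto
  then have "i = 0 \<or> i = -1" "j = 0 \<or> j = -1" by linarith+
  then show "x \<in> {-1/2, 1/2}" "y \<in> {-1/2, 1/2}" using \<open>x = _\<close> \<open>y = _\<close> by auto
qed

lemma int_pair:
  fixes x y :: real
  assumes "x \<in> \<int>" "y \<in> \<int>" "\<bar>x\<bar> + \<bar>y\<bar> < 2"
  shows "x \<in> {-1, 1} \<and> y = 0 \<or> y \<in> {-1, 1} \<and> x = 0 \<or> x = 0 \<and> y = 0"
proof -
  obtain i j :: int where ij: "x = of_int i" "y = of_int j" using assms(1,2) by (auto elim!: Ints_cases)
  then have "real_of_int (\<bar>i\<bar> + \<bar>j\<bar>) < 2" using assms(3) by simp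
  then have "\<bar>i\<bar> + \<bar>j\<bar> < 2" by linarith
  then have "\<bar>i\<bar> = 1 \<and> j = 0 \<or> \<bar>j\<bar> = 1 \<and> i = 0 \<or> i = 0 \<and> j = 0" by linarith
  then show ?thesis using ij by (auto simp: abs_if split: if_splits)
qed

lemma near_half_cases:
  fixes x t :: real
  assumes "x - (1/2 + t) \<in> \<int>" "\<bar>t\<bar> \<le> 1/100"
  shows "49/100 \<le> \<bar>x\<bar>" "(\<exists>\<sigma>\<in>{-1,1}. x = \<sigma>/2 + t) \<or> 149/100 \<le> \<bar>x\<bar>"
proof -
  obtain i :: int where i: "x = 1/2 + t + of_int i" using assms(1) by (metis Ints_cases add_diff_cancel_left' diff_add_cancel add.commute)
  consider "i = 0" | "i = -1" | "i \<ge> 1" | "i \<le> -2" by linarith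
  then have "49/100 \<le> \<bar>x\<bar> \<and> ((\<exists>\<sigma>\<in>{-1,1}. x = \<sigma>/2 + t) \<or> 149/100 \<le> \<bar>x\<bar>)"
  proof cases
    case 3
    then have "real_of_int i \<ge> 1" by simp
    then show ?thesis using i assms(2) by linarith
  next
    case 4
    then have "real_of_int i \<le> -2" by simp
    then show ?thesis using i assms(2) by linarith
  qed (use i assms(2) in auto)
  then show "49/100 \<le> \<bar>x\<bar>" "(\<exists>\<sigma>\<in>{-1,1}. x = \<sigma>/2 + t) \<or> 149/100 \<le> \<bar>x\<bar>" by auto
qed

section \<open>Remainders, convergents and the lattice basis of a level\<close>

declare nicf_a.simps(2) [simp del] nicf_eps.simps(3) [simp del] nicf_rem.simps(2) [simp del]

locale nicf =
  fixes \<alpha> :: real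
  assumes irrational: "\<alpha> \<notin> \<rat>" and pos: "0 < \<alpha>" and less_half: "\<alpha> < 1 / 2"
begin

abbreviation "a \<equiv> nicf_a \<alpha>"
abbreviation "e \<equiv> nicf_eps \<alpha>"
abbreviation "r \<equiv> nicf_rem \<alpha>"

lemma eps_cases: "e k = 1 \<or> e k = -1"
  by (cases "(\<alpha>, k)" rule: nicf_eps.cases) (auto simp: nicf_eps.simps(3))

lemma eps_sq: "real_of_int (e k) * real_of_int (e k) = 1" "\<bar>real_of_int (e k)\<bar> = 1"
  using eps_cases[of k] by auto

text \<open>Irrationality is carried through the induction; it makes the bounds 0 and 1/2 for a
  distance to the nearest integer strict.\<close>

lemma rem_bounds: "0 < r k" "r k < 1/2"
proof -
  have "r k \<notin> \<rat> \<and> 0 < r k \<and> r k < 1/2"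
  proof (induction k)
    case 0
    show ?case using irrational pos less_half by simp
  next
    case (Suc k)
    define x where "x = 1 / r k"
    have x: "x \<notin> \<rat>" using Suc unfolding x_def by (metis Rats_1 Rats_divide div_by_1 divide_divide_eq_right mult_1)
    have irr: "dist_nint x \<notin> \<rat>"
    proof
      assume "dist_nint x \<in> \<rat>"
      then have "x - of_int (round x) \<in> \<rat>" unfolding dist_nint_def
        by (metis Rats_minus_iff abs_if)
      then have "x - of_int (round x) + of_int (round x) \<in> \<rat>" by (intro Rats_add) auto
      then show False using x by simp
    qed
    moreover have "0 \<le> dist_nint x" "dist_nint x \<le> 1/2"
      using of_int_round_abs_le[of x] by (auto simp: dist_nint_def abs_minus_commute)
    moreover have "(0::real) \<in> \<rat>" "(1/2::real) \<in> \<rat>" by auto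
    ultimately have "0 < dist_nint x" "dist_nint x < 1/2" by (metis less_eq_real_def)+
    then show ?case using irr by (simp add: x_def nicf_rem.simps)
  qed
  then show "0 < r k" "r k < 1/2" by auto
qed

lemma inverse_rem: "1 / r k = a (Suc k) + e (Suc (Suc k)) * r (Suc k)"
proof -
  have "\<lceil>x\<rceil> = \<lfloor>x\<rfloor> + 1" if "x \<notin> \<int>" for x :: real
    using that by (metis Ints_of_int ceiling_altdef)
  then show ?thesis
    by (cases "1 / r k" rule: dist_nint_cases)
       (auto simp: frac_def nicf_a.simps nicf_eps.simps nicf_rem.simps )
qed

lemma partial_quotient_ge_2: "a (Suc k) \<ge> 2"
proof -
  have "1 / r k > 2" using rem_bounds[of k] by (simp add: field_simps)
  moreover have "\<bar>e (Suc (Suc k)) * r (Suc k)\<bar> < 1/2"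
    using rem_bounds[of "Suc k"] eps_sq[of "Suc (Suc k)"] by (simp add: abs_mult)
  ultimately have "real_of_int (a (Suc k)) > 3/2" using inverse_rem[of k] by linarith
  then show ?thesis by linarith
qed

text \<open>The index is shifted by one against the usual convergents, so that \<open>Q 0\<close> is the denominator \<open>q\<^sub>-\<^sub>1 = 0\<close>.\<close>

fun Q :: "nat \<Rightarrow> real" where
  "Q 0 = 0" | "Q (Suc 0) = 1" | "Q (Suc (Suc k)) = a (Suc k) * Q (Suc k) + e (Suc k) * Q k"

text \<open>These are the differences \<open>Q k * \<alpha> - P k\<close>, with \<open>P\<close> the
  numerators under the same index shift; the start values are 0 * \<alpha> - 1 and 1 * \<alpha> -
  0.\<close>

fun D :: "nat \<Rightarrow> real" where
  "D 0 = -1" | "D (Suc 0) = \<alpha>" | "D (Suc (Suc k)) = a (Suc k) * D (Suc k) + e (Suc k) * D k"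

text \<open>By \<open>b_Suc\<close> this is the continued fraction of the partial quotients up to
  index \<open>k\<close> read backwards, the counterpart of \<open>r k\<close>, which is built from
  the later ones.\<close>

definition b :: "nat \<Rightarrow> real" where "b k = Q k / Q (Suc k)"

text \<open>Partial quotients are at least 2, so the denominators do not decrease even where the
  sign is -1.\<close>

lemma Q_mono: "0 \<le> Q k" "Q k \<le> Q (Suc k)" "1 \<le> Q (Suc k)"
proof -
  have "0 \<le> Q k \<and> Q k \<le> Q (Suc k) \<and> 1 \<le> Q (Suc k)"
  proof (induction k)
    case (Suc k)
    have "2 * Q (Suc k) \<le> a (Suc k) * Q (Suc k)"
      using partial_quotient_ge_2[of k] Suc by (intro mult_right_mono) auto
    moreover have "Q (Suc (Suc k)) = a (Suc k) * Q (Suc k) + e (Suc k) * Q k" by simp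
    moreover have "e (Suc k) * Q k = Q k \<or> e (Suc k) * Q k = - Q k" using eps_cases[of "Suc k"] by auto
    ultimately have "Q (Suc k) \<le> Q (Suc (Suc k))" using Suc by linarith
    then show ?case using Suc by (simp del: Q.simps)
  qed simp
  then show "0 \<le> Q k" "Q k \<le> Q (Suc k)" "1 \<le> Q (Suc k)" by auto
qed

lemma b_bounds: "0 \<le> b k" "b k \<le> 1"
  using Q_mono[of k] by (auto simp: b_def)

lemma b_Suc: "b (Suc k) = 1 / (a (Suc k) + e (Suc k) * b k)"
  using Q_mono[of k] by (simp add: b_def field_simps)

lemma D_Suc: "D (Suc k) = - e (Suc k) * r k * D k"
proof (induction k)
  case (Suc k)
  have "e (Suc k) * D (Suc k) = - r k * D k"
    unfolding Suc using eps_cases[of "Suc k"] by auto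
  then have "D k = - e (Suc k) * D (Suc k) * (1 / r k)"
    using rem_bounds[of k] by (simp add: field_simps)
  then have "e (Suc k) * D k = - (real_of_int (e (Suc k)) * real_of_int (e (Suc k))) * (D (Suc k) * (1 / r k))"
    by simp
  then have "e (Suc k) * D k = - D (Suc k) * (1 / r k)" unfolding eps_sq by simp
  then show ?case unfolding inverse_rem by (simp add: algebra_simps)
qed simp

lemma D_nonzero: "D k \<noteq> 0"
proof (induction k)
  case (Suc k)
  then show ?case unfolding D_Suc using rem_bounds[of k] eps_cases[of "Suc k"] by auto
qed simp

lemma abs_D_Suc: "\<bar>D (Suc k)\<bar> = r k * \<bar>D k\<bar>"
  unfolding D_Suc using rem_bounds[of k] eps_sq[of "Suc k"] by (simp add: abs_mult)

lemma abs_D_le: "\<bar>D k\<bar> \<le> (1/2) ^ k"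
proof (induction k)
  case (Suc k)
  have "r k * \<bar>D k\<bar> \<le> (1/2) * (1/2) ^ k"
    using Suc rem_bounds[of k] by (intro mult_mono) auto
  then show ?case by (simp add: abs_D_Suc)
qed simp

lemma D_tendsto_0: "D \<longlonglongrightarrow> 0"
proof (rule tendsto_rabs_zero_cancel, rule tendsto_sandwich[of "\<lambda>_. 0" _ _ "\<lambda>k. (1/2) ^ k"])
  show "(\<lambda>k. (1/2::real) ^ k) \<longlonglongrightarrow> 0" by (rule LIMSEQ_realpow_zero) auto
qed (use abs_D_le in auto)

lemma determinant_bounds: "1/2 \<le> 1 + e (Suc k) * r k * b k" "1 + e (Suc k) * r k * b k \<le> 3/2"
proof -
  have "r k * b k \<le> (1/2) * 1" using rem_bounds[of k] b_bounds[of k] by (intro mult_mono) auto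
  moreover have "0 \<le> r k * b k" using rem_bounds[of k] b_bounds[of k] by simp
  ultimately show "1/2 \<le> 1 + e (Suc k) * r k * b k" "1 + e (Suc k) * r k * b k \<le> 3/2"
    using eps_cases[of "Suc k"] by (auto simp: mult.assoc)
qed

lemma determinant_pos: "0 < 1 + e (Suc k) * r k * b k"
  using determinant_bounds(1)[of k] by linarith

text \<open>Consecutive vectors (Q, D) have determinant 1 or -1, since the recurrence changes it
  only by a sign. Factoring out \<open>Q (Suc k)\<close> and \<open>D k\<close> leaves the
  denominator of \<open>corner\<close>.\<close>

lemma determinant: "Q (Suc k) * \<bar>D k\<bar> * (1 + e (Suc k) * r k * b k) = 1"
proof -
  have "\<bar>Q (Suc k) * D k - Q k * D (Suc k)\<bar> = 1"
  proof (induction k)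
    case (Suc k)
    have "Q (Suc (Suc k)) * D (Suc k) - Q (Suc k) * D (Suc (Suc k))
        = - e (Suc k) * (Q (Suc k) * D k - Q k * D (Suc k))"
      by (simp add: algebra_simps)
    then show ?case using Suc eps_sq[of "Suc k"] by (simp add: abs_mult del: Q.simps D.simps)
  qed simp
  moreover have "Q (Suc k) * D k - Q k * D (Suc k) = Q (Suc k) * D k * (1 + e (Suc k) * r k * b k)"
    unfolding D_Suc b_def using Q_mono[of k] by (simp add: field_simps)
  ultimately show ?thesis
    using determinant_pos[of k] Q_mono[of k] by (simp add: abs_mult)
qed

text \<open>The plane point \<open>(x, \<alpha> x - y)\<close> has coordinates \<open>(e k * coord x y k, coord x y (Suc k))\<close> with respect to the
  basis \<open>(Q (Suc k), D (Suc k))\<close>, \<open>(Q k, D k)\<close>.\<close>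

fun coord :: "real \<Rightarrow> real \<Rightarrow> nat \<Rightarrow> real" where
  "coord x y 0 = x" | "coord x y (Suc 0) = y"
| "coord x y (Suc (Suc k)) = e k * coord x y k - e (Suc k) * a (Suc k) * coord x y (Suc k)"

lemma coord_add: "coord (x + x') (y + y') k = coord x y k + coord x' y' k"
  by (induction x y k rule: coord.induct) (auto simp: algebra_simps)

lemma coord_Ints:
  assumes "x \<in> \<int>" "y \<in> \<int>"
  shows "coord x y k \<in> \<int>"
  using assms by (induction x y k rule: coord.induct) (auto intro!: Ints_diff Ints_mult)

text \<open>The recursion for \<open>coord\<close> can be run backwards with integer coefficients,
  so nothing is lost by working in the coordinates of one level, neither over the reals nor over the
  integers.\<close>

lemma coord_surj: "\<exists>x y. e k * coord x y k = u \<and> coord x y (Suc k) = v \<and> (u \<in> \<int> \<and> v \<in> \<int> \<longrightarrow> x \<in> \<int> \<and> y \<in> \<int>)"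
proof (induction k arbitrary: u v)
  case 0
  show ?case by (intro exI[of _ u] exI[of _ v]) auto
next
  case (Suc k)
  obtain x y where xy: "e k * coord x y k = v + a (Suc k) * u" "coord x y (Suc k) = e (Suc k) * u"
      "v + a (Suc k) * u \<in> \<int> \<and> e (Suc k) * u \<in> \<int> \<longrightarrow> x \<in> \<int> \<and> y \<in> \<int>"
    using Suc.IH by blast
  have "coord x y (Suc (Suc k)) = v + a (Suc k) * u - (real_of_int (e (Suc k)) * real_of_int (e (Suc k))) * (a (Suc k) * u)"
    using xy by (simp add: algebra_simps)
  then have "coord x y (Suc (Suc k)) = v" unfolding eps_sq by simp
  moreover have "e (Suc k) * coord x y (Suc k) = (real_of_int (e (Suc k)) * real_of_int (e (Suc k))) * u" using xy by simp
  then have "e (Suc k) * coord x y (Suc k) = u" unfolding eps_sq by simp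
  moreover have "u \<in> \<int> \<and> v \<in> \<int> \<longrightarrow> x \<in> \<int> \<and> y \<in> \<int>" using xy(3) by auto
  ultimately show ?case by blast
qed

lemma coord_fst: "Q (Suc k) * (e k * coord x y k + b k * coord x y (Suc k)) = x"
proof -
  have "Q (Suc k) * (e k * coord x y k) + Q k * coord x y (Suc k) = x"
  proof (induction k)
    case (Suc k)
    have "Q (Suc (Suc k)) * (e (Suc k) * coord x y (Suc k)) + Q (Suc k) * coord x y (Suc (Suc k))
       = (real_of_int (e (Suc k)) * real_of_int (e (Suc k))) * Q k * coord x y (Suc k) + Q (Suc k) * (e k * coord x y k)"
      by (simp add: algebra_simps)
    then show ?case using Suc unfolding eps_sq by simp
  qed simp
  then show ?thesis using Q_mono[of k] by (simp add: b_def field_simps)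
qed

lemma coord_snd: "D k * (coord x y (Suc k) - e (Suc k) * r k * (e k * coord x y k)) = \<alpha> * x - y"
proof -
  have "D (Suc k) * (e k * coord x y k) + D k * coord x y (Suc k) = \<alpha> * x - y"
  proof (induction k)
    case (Suc k)
    have "D (Suc (Suc k)) * (e (Suc k) * coord x y (Suc k)) + D (Suc k) * coord x y (Suc (Suc k))
       = (real_of_int (e (Suc k)) * real_of_int (e (Suc k))) * D k * coord x y (Suc k) + D (Suc k) * (e k * coord x y k)"
      by (simp add: algebra_simps)
    then show ?case using Suc unfolding eps_sq by simp
  qed simp
  then show ?thesis unfolding D_Suc by (simp add: algebra_simps)
qed

section \<open>The lower limit seen in level coordinates\<close>

lemma product_eq_corner:
  "\<bar>x\<bar> * \<bar>\<alpha> * x - y\<bar> = corner (e (Suc k)) (r k) (b k) (e k * coord x y k) (coord x y (Suc k))"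
proof -
  define X Y where "X = e k * coord x y k" and "Y = coord x y (Suc k)"
  define d where "d = 1 + e (Suc k) * r k * b k"
  have "\<bar>x\<bar> * \<bar>\<alpha> * x - y\<bar> = \<bar>Q (Suc k) * (X + b k * Y)\<bar> * \<bar>D k * (Y - e (Suc k) * r k * X)\<bar>"
    unfolding X_def Y_def coord_fst coord_snd ..
  also have "\<dots> = (Q (Suc k) * \<bar>D k\<bar>) * \<bar>(X + b k * Y) * (Y - e (Suc k) * r k * X)\<bar>"
    using Q_mono[of k] by (simp add: abs_mult)
  also have "Q (Suc k) * \<bar>D k\<bar> = 1 / d"
    using determinant[of k] determinant_pos[of k] unfolding d_def by (simp add: field_simps)
  finally show ?thesis unfolding corner_def X_def Y_def d_def by simp
qed

text \<open>Grid points with bounded level coordinates have |n\<alpha> - \<gamma> - m| at most 2 |D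
  k|, which tends to 0. The finitely many \<open>n\<close> with |n| < \<open>n0\<close> keep a
  positive distance \<open>d\<close> because \<gamma> is not in Z + \<alpha>Z, so only large |n|
  occur at deep levels.\<close>

lemma corner_ge_of_less_inhom_M:
  assumes \<gamma>: "\<gamma> \<notin> {of_int m + \<alpha> * of_int n | m n :: int. True}" and M: "ereal c < inhom_M \<alpha> \<gamma>"
  shows "\<exists>k0. \<forall>k\<ge>k0. \<forall>x y. x - e k * coord 0 \<gamma> k \<in> \<int> \<longrightarrow> y - coord 0 \<gamma> (Suc k) \<in> \<int> \<longrightarrow>
    \<bar>x\<bar> \<le> 1 \<longrightarrow> \<bar>y\<bar> \<le> 1 \<longrightarrow> c \<le> corner (e (Suc k)) (r k) (b k) x y"
proof -
  have "eventually (\<lambda>n. c < \<bar>of_int n\<bar> * dist_nint (of_int n * \<alpha> - \<gamma>)) (filtercomap (\<lambda>n::int. \<bar>n\<bar>) at_top)"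
    using less_LiminfD[OF M[unfolded inhom_M_def]] by simp
  then obtain n0 :: int where n0: "\<And>n::int. n0 \<le> \<bar>n\<bar> \<Longrightarrow> c < \<bar>of_int n\<bar> * dist_nint (of_int n * \<alpha> - \<gamma>)"
    unfolding eventually_filtercomap eventually_at_top_linorder by blast
  define d where "d = Min ((\<lambda>n::int. dist_nint (of_int n * \<alpha> - \<gamma>)) ` {-\<bar>n0\<bar>..\<bar>n0\<bar>})"
  have "0 < dist_nint (of_int n * \<alpha> - \<gamma>)" for n :: int
  proof (rule dist_nint_pos, rule notI)
    assume "of_int n * \<alpha> - \<gamma> \<in> \<int>"
    then obtain i where "of_int n * \<alpha> - \<gamma> = of_int i" by (auto elim: Ints_cases)
    then have "\<gamma> = of_int (-i) + \<alpha> * of_int n" by (simp add: algebra_simps)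
    then show False using \<gamma> by blast
  qed
  then have d: "0 < d" unfolding d_def by (subst Min_gr_iff) auto
  have d_le: "d \<le> dist_nint (of_int n * \<alpha> - \<gamma>)" if "\<bar>n\<bar> < n0" for n :: int
    unfolding d_def using that by (intro Min_le imageI) auto
  have "\<forall>\<^sub>F k in sequentially. \<bar>D k\<bar> < d / 2"
    using tendsto_rabs_zero[OF D_tendsto_0] d by (intro order_tendstoD(2)[of _ 0]) auto
  then obtain k0 where k0: "\<And>k. k \<ge> k0 \<Longrightarrow> \<bar>D k\<bar> < d / 2"
    unfolding eventually_sequentially by blast
  have "c \<le> corner (e (Suc k)) (r k) (b k) x y"
    if k: "k0 \<le> k" and x: "x - e k * coord 0 \<gamma> k \<in> \<int>" and y: "y - coord 0 \<gamma> (Suc k) \<in> \<int>"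
      and xy: "\<bar>x\<bar> \<le> 1" "\<bar>y\<bar> \<le> 1" for k x y
  proof -
    obtain x' y' where xy': "e k * coord x' y' k = x - e k * coord 0 \<gamma> k"
        "coord x' y' (Suc k) = y - coord 0 \<gamma> (Suc k)" "x' \<in> \<int>" "y' \<in> \<int>"
      using coord_surj[of k] x y by metis
    then obtain n m :: int where nm: "x' = of_int n" "y' = of_int m" by (auto elim!: Ints_cases)
    have xe: "x = e k * coord n (m + \<gamma>) k" and ye: "y = coord n (m + \<gamma>) (Suc k)"
      using xy'(1,2) coord_add[of n 0 m \<gamma> k] coord_add[of n 0 m \<gamma> "Suc k"] unfolding nm
      by (simp_all add: distrib_left del: coord.simps)
    have pr: "\<bar>real_of_int n\<bar> * \<bar>\<alpha> * n - (m + \<gamma>)\<bar> = corner (e (Suc k)) (r k) (b k) x y"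
      unfolding xe ye by (rule product_eq_corner)
    have le: "dist_nint (of_int n * \<alpha> - \<gamma>) \<le> \<bar>\<alpha> * n - (m + \<gamma>)\<bar>"
      using dist_nint_le[of "of_int n * \<alpha> - \<gamma>" m] by (simp add: algebra_simps)
    have "n0 \<le> \<bar>n\<bar>"
    proof (rule ccontr)
      assume "\<not> n0 \<le> \<bar>n\<bar>"
      then have "d \<le> \<bar>\<alpha> * n - (m + \<gamma>)\<bar>" using d_le[of n] le by simp
      also have "\<dots> = \<bar>D k\<bar> * \<bar>y - e (Suc k) * r k * x\<bar>"
        unfolding xe ye abs_mult[symmetric] coord_snd ..
      also have "\<bar>y - e (Suc k) * r k * x\<bar> \<le> 2"
      proof -
        have "\<bar>e (Suc k) * r k * x\<bar> = r k * \<bar>x\<bar>"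
          using eps_sq[of "Suc k"] rem_bounds[of k] by (simp add: abs_mult)
        also have "\<dots> \<le> (1/2) * 1" using rem_bounds[of k] xy by (intro mult_mono) auto
        finally show ?thesis using xy by linarith
      qed
      finally have "d \<le> \<bar>D k\<bar> * 2" by (simp add: mult_left_mono)
      then show False using k0[OF k] by linarith
    qed
    from n0[OF this] show ?thesis
      using mult_left_mono[OF le, of "\<bar>real_of_int n\<bar>"] pr by linarith
  qed
  then show ?thesis by blast
qed

text \<open>At any level the grid has a point with both coordinates at most 1/2 in absolute value,
  where the form is at most 3/2. This crude bound serves the small values of
  \<open>R\<close>.\<close>

lemma inhom_M_le_2:
  assumes \<gamma>: "\<gamma> \<notin> {of_int m + \<alpha> * of_int n | m n :: int. True}"
  shows "inhom_M \<alpha> \<gamma> \<le> ereal 2"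
proof (rule ccontr)
  assume "\<not> inhom_M \<alpha> \<gamma> \<le> ereal 2"
  then obtain k where k: "\<And>x y. x - e k * coord 0 \<gamma> k \<in> \<int> \<Longrightarrow> y - coord 0 \<gamma> (Suc k) \<in> \<int> \<Longrightarrow>
    \<bar>x\<bar> \<le> 1 \<Longrightarrow> \<bar>y\<bar> \<le> 1 \<Longrightarrow> 2 \<le> corner (e (Suc k)) (r k) (b k) x y"
    using corner_ge_of_less_inhom_M[OF \<gamma>, of 2] by (metis not_le order_refl)
  define x where "x = e k * coord 0 \<gamma> k - of_int (round (e k * coord 0 \<gamma> k))"
  define y where "y = coord 0 \<gamma> (Suc k) - of_int (round (coord 0 \<gamma> (Suc k)))"
  have xy: "\<bar>x\<bar> \<le> 1/2" "\<bar>y\<bar> \<le> 1/2"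
    unfolding x_def y_def using of_int_round_abs_le abs_minus_commute by metis+
  have two: "2 \<le> corner (e (Suc k)) (r k) (b k) x y"
    using xy by (intro k) (auto simp: x_def y_def simp del: coord.simps)
  note rb = rem_bounds[of k] b_bounds[of k]
  have "\<bar>b k * y\<bar> \<le> 1 * (1/2)" unfolding abs_mult using xy rb by (intro mult_mono) auto
  moreover have "\<bar>r k * x\<bar> \<le> (1/2) * (1/2)" unfolding abs_mult using xy rb by (intro mult_mono) auto
  moreover have "\<bar>e (Suc k) * r k * x\<bar> = \<bar>r k * x\<bar>" using eps_cases[of "Suc k"] by auto
  ultimately have 1: "\<bar>x + b k * y\<bar> \<le> 1" and 2: "\<bar>y - e (Suc k) * r k * x\<bar> \<le> 3/4" using xy by linarith+
  have 3: "\<bar>(x + b k * y) * (y - e (Suc k) * r k * x)\<bar> \<le> 1 * (3/4)"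
    unfolding abs_mult[of "x + b k * y"] using 1 2 by (intro mult_mono) auto
  have "corner (e (Suc k)) (r k) (b k) x y \<le> (1 * (3/4)) / (1/2)"
    unfolding corner_def using 3 determinant_bounds(1)[of k] by (intro frac_le) auto
  then show False using two by simp
qed

text \<open>A grid point far out on a hyperbola branch is compared at the level where the ratio of its rescaled
  coordinates lies between \<open>w\<close> and \<open>2 / w\<close>; there it has to be one of the four corners. The first coordinates of
  the grid prescribed by \<open>S\<close> need not be integers; moving it horizontally to make them so does not change the
  lower limit.\<close>

lemma inhom_M_ge:
  fixes S :: "nat \<Rightarrow> real"
  assumes w: "0 < w" "w \<le> 1/100000"
    and cong: "\<And>k. K \<le> k \<Longrightarrow> S (Suc (Suc k)) - (e k * S k - e (Suc k) * a (Suc k) * S (Suc k)) \<in> \<int>"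
    and near: "\<And>k. K \<le> k \<Longrightarrow> \<bar>S k - 1/2\<bar> \<le> 2 * w"
    and rb: "\<And>k. K \<le> k \<Longrightarrow> 9/10 * w \<le> r k" "\<And>k. K \<le> k \<Longrightarrow> r k \<le> 11/10 * w"
      "\<And>k. K \<le> k \<Longrightarrow> 9/10 * w \<le> b k" "\<And>k. K \<le> k \<Longrightarrow> b k \<le> 11/10 * w"
    and F: "\<And>k \<sigma> \<tau>. K \<le> k \<Longrightarrow> \<sigma> \<in> {-1,1} \<Longrightarrow> \<tau> \<in> {-1,1} \<Longrightarrow>
      c \<le> corner (e (Suc k)) (r k) (b k) (\<sigma>/2 + e k * (S k - 1/2)) (\<tau>/2 + (S (Suc k) - 1/2))"
    and c: "c \<le> 1/4" and \<delta>: "0 < \<delta>"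
  shows "\<exists>\<gamma>. \<gamma> \<notin> {of_int m + \<alpha> * of_int n | m n :: int. True} \<and> ereal (c - \<delta>) \<le> inhom_M \<alpha> \<gamma>"
proof -
  \<comment> \<open>The grid is fixed by prescribing its coordinates at level \<open>K\<close>;
    \<open>cong\<close> then propagates agreement with \<open>S\<close> modulo integers to all later
    levels.\<close>
  obtain x0 y0 where x0: "e K * coord x0 y0 K = e K * S K" and y0: "coord x0 y0 (Suc K) = S (Suc K)"
    using coord_surj by metis
  have x0': "coord x0 y0 K = S K" using x0 eps_cases[of K] by auto
  have grid: "coord (x0 + of_int n) (y0 + of_int m) k - S k \<in> \<int>" if "K \<le> k" for n m :: int and k
  proof -
    have "coord x0 y0 k - S k \<in> \<int> \<and> coord x0 y0 (Suc k) - S (Suc k) \<in> \<int>"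
      using that
    proof (induction k rule: dec_induct)
      case base
      show ?case using x0' y0 by simp
    next
      case (step k)
      have "coord x0 y0 (Suc (Suc k)) - S (Suc (Suc k))
        = e k * (coord x0 y0 k - S k) - e (Suc k) * a (Suc k) * (coord x0 y0 (Suc k) - S (Suc k))
          - (S (Suc (Suc k)) - (e k * S k - e (Suc k) * a (Suc k) * S (Suc k)))"
        by (simp add: algebra_simps)
      also have "\<dots> \<in> \<int>"
        using step.IH cong[OF step.hyps(1)] by (intro Ints_diff[OF Ints_diff] Ints_mult Ints_of_int) auto
      finally show ?case using step.IH by blast
    qed
    then have "(coord x0 y0 k - S k) + coord (of_int n) (of_int m) k \<in> \<int>"
      by (intro Ints_add coord_Ints) auto
    then show ?thesis unfolding coord_add by (simp add: algebra_simps)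
  qed
  have half: "X - (1/2 + e k * (S k - 1/2)) \<in> \<int>" "\<bar>e k * (S k - 1/2)\<bar> \<le> 1/100"
      "Y - (1/2 + (S (Suc k) - 1/2)) \<in> \<int>" "\<bar>S (Suc k) - 1/2\<bar> \<le> 1/100"
    if k: "K \<le> k" and X: "X = e k * coord (x0 + of_int n) (y0 + of_int m) k"
      and Y: "Y = coord (x0 + of_int n) (y0 + of_int m) (Suc k)" for X Y n m k
  proof -
    have "X - e k * S k \<in> \<int>" unfolding X right_diff_distrib[symmetric]
      using grid[OF k] by (intro Ints_mult) auto
    moreover have "e k * S k - (1/2 + e k * (S k - 1/2)) \<in> \<int>"
      using eps_cases[of k] by (elim disjE) (simp_all add: algebra_simps)
    ultimately have "(X - e k * S k) + (e k * S k - (1/2 + e k * (S k - 1/2))) \<in> \<int>" by (rule Ints_add)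
    then show "X - (1/2 + e k * (S k - 1/2)) \<in> \<int>" by (simp only: diff_add_eq_diff_diff_swap diff_add_cancel add_diff_eq)
    show "Y - (1/2 + (S (Suc k) - 1/2)) \<in> \<int>" unfolding Y using grid[of "Suc k" n m] k by simp
    show "\<bar>e k * (S k - 1/2)\<bar> \<le> 1/100" "\<bar>S (Suc k) - 1/2\<bar> \<le> 1/100"
      using near[OF k] near[of "Suc k"] k w eps_sq[of k] by (auto simp: abs_mult)
  qed
  \<comment> \<open>Now \<open>\<alpha> * (x0 + n) - (y0 + m)\<close> equals n\<alpha> - \<gamma> -
    m, so this grid differs from the one of \<gamma> only by the horizontal displacement
    \<open>x0\<close>.\<close>
  define \<gamma> where "\<gamma> = y0 - \<alpha> * x0"
  \<comment> \<open>A grid point on the horizontal axis would have |x| = |X| |D k|, which tends to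
    0, whereas first coordinates have absolute value at least 49/100 from level \<open>K\<close>
    on.\<close>
  have nz: "\<alpha> * (x0 + of_int n) - (y0 + of_int m) \<noteq> 0" for n m :: int
  proof
    assume Y0: "\<alpha> * (x0 + of_int n) - (y0 + of_int m) = 0"
    define X where "X = x0 + of_int n"
    have "\<forall>\<^sub>F k in sequentially. \<bar>D k\<bar> < 1 / (10 * (\<bar>X\<bar> + 1))"
      using tendsto_rabs_zero[OF D_tendsto_0] by (intro order_tendstoD(2)[of _ 0]) auto
    then obtain k where k: "K \<le> k" "\<bar>D k\<bar> < 1 / (10 * (\<bar>X\<bar> + 1))"
      unfolding eventually_sequentially by (metis le_cases)
    define x y where "x = e k * coord X (y0 + of_int m) k" and "y = coord X (y0 + of_int m) (Suc k)"
    define d where "d = 1 + e (Suc k) * r k * b k"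
    have d: "1/2 \<le> d" unfolding d_def by (rule determinant_bounds)
    have "D k * (y - e (Suc k) * r k * x) = 0"
      unfolding x_def y_def coord_snd using Y0 by (simp add: X_def)
    then have "y = e (Suc k) * r k * x" using D_nonzero by simp
    moreover have "Q (Suc k) * (x + b k * y) = X" unfolding x_def y_def by (rule coord_fst)
    ultimately have "Q (Suc k) * (x * d) = X" by (simp add: d_def algebra_simps)
    then have "\<bar>X\<bar> = Q (Suc k) * \<bar>x\<bar> * d" using Q_mono[of k] d by (auto simp: abs_mult)
    then have "\<bar>X\<bar> * \<bar>D k\<bar> = \<bar>x\<bar> * (Q (Suc k) * \<bar>D k\<bar> * d)" by simp
    then have xX: "\<bar>x\<bar> = \<bar>X\<bar> * \<bar>D k\<bar>" unfolding d_def determinant by simp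
    also have "\<dots> \<le> (\<bar>X\<bar> + 1) * (1 / (10 * (\<bar>X\<bar> + 1)))" using k by (intro mult_mono) auto
    also have "\<dots> = 1/10" by (simp add: field_simps)
    finally have "\<bar>x\<bar> \<le> 1/10" .
    moreover have "49/100 \<le> \<bar>x\<bar>"
      using half(1,2)[OF k(1) _ refl, of x n m] by (intro near_half_cases(1)) (auto simp: x_def X_def)
    ultimately show False by simp
  qed
  have key: "c \<le> \<bar>X\<bar> * \<bar>\<alpha> * X - Y\<bar>"
    if X: "X = x0 + of_int n" and Y: "Y = y0 + of_int m" and X0: "X \<noteq> 0"
      and f0: "w \<le> \<bar>X\<bar> * \<bar>D K\<bar> / (Q (Suc K) * \<bar>\<alpha> * X - Y\<bar>)" for X Y n m
  proof (rule ccontr)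
    assume "\<not> c \<le> \<bar>X\<bar> * \<bar>\<alpha> * X - Y\<bar>"
    then have lt: "\<bar>X\<bar> * \<bar>\<alpha> * X - Y\<bar> < c" by simp
    define \<eta>0 where "\<eta>0 = \<bar>\<alpha> * X - Y\<bar>"
    have \<eta>0: "0 < \<eta>0" unfolding \<eta>0_def X Y using nz by simp
    \<comment> \<open>The ratio |\<xi>| / |\<eta>| of the rescaled coordinates at level
      \<open>k\<close>, see \<open>fe\<close>. It is at least \<open>w\<close> at level
      \<open>K\<close> by \<open>f0\<close> and falls below \<open>w\<close> later, so it crosses
      \<open>w\<close> between two consecutive levels.\<close>
    define f where "f k = \<bar>X\<bar> * \<bar>D k\<bar> / (Q (Suc k) * \<eta>0)" for k
    have f_Suc: "f (Suc k) = f k * (r k * b (Suc k))" for k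
      unfolding f_def abs_D_Suc b_def using Q_mono(3)[of k] by (simp add: mult.commute del: Q.simps)
    have "\<forall>\<^sub>F k in sequentially. \<bar>D k\<bar> < w * \<eta>0 / \<bar>X\<bar>"
      using tendsto_rabs_zero[OF D_tendsto_0] w \<eta>0 X0 by (intro order_tendstoD(2)[of _ 0]) auto
    then obtain k1 where k1: "K \<le> k1" "\<bar>D k1\<bar> < w * \<eta>0 / \<bar>X\<bar>"
      unfolding eventually_sequentially by (metis le_cases)
    have "f k1 < w"
    proof -
      have "\<bar>X\<bar> * \<bar>D k1\<bar> < w * \<eta>0" using k1 X0 by (simp add: field_simps)
      also have "w * \<eta>0 \<le> Q (Suc k1) * (w * \<eta>0)"
        using mult_right_mono[OF Q_mono(3)[of k1], of "w * \<eta>0"] w \<eta>0 by simp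
      finally show ?thesis unfolding f_def using Q_mono(3)[of k1] \<eta>0 by (simp add: field_simps)
    qed
    have "\<exists>k\<ge>K. w \<le> f k \<and> f (Suc k) < w"
    proof (rule ccontr)
      assume no: "\<not> (\<exists>k\<ge>K. w \<le> f k \<and> f (Suc k) < w)"
      have "w \<le> f k1" using k1(1)
      proof (induction k1 rule: dec_induct)
        case base
        show ?case using f0 unfolding f_def \<eta>0_def .
      next
        case (step k)
        then show ?case using no by (metis not_le)
      qed
      then show False using \<open>f k1 < w\<close> by simp
    qed
    then obtain k where k: "K \<le> k" and fk: "w \<le> f k" "f (Suc k) < w" by blast
    define x y where "x = e k * coord X Y k" and "y = coord X Y (Suc k)"
    define \<xi> \<eta> where "\<xi> = x + b k * y" and "\<eta> = y - e (Suc k) * r k * x"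
    define d where "d = 1 + e (Suc k) * r k * b k"
    have Xe: "Q (Suc k) * \<xi> = X" unfolding \<xi>_def x_def y_def by (rule coord_fst)
    have Ye: "D k * \<eta> = \<alpha> * X - Y" unfolding \<eta>_def x_def y_def by (rule coord_snd)
    have \<eta>n: "\<bar>\<eta>\<bar> > 0" using Ye \<eta>0 unfolding \<eta>0_def by auto
    have Qp: "0 < Q (Suc k)" using Q_mono(3)[of k] by linarith
    have fe: "f k = \<bar>\<xi>\<bar> / \<bar>\<eta>\<bar>"
    proof -
      have "f k = (Q (Suc k) * \<bar>\<xi>\<bar>) * \<bar>D k\<bar> / (Q (Suc k) * (\<bar>D k\<bar> * \<bar>\<eta>\<bar>))"
        unfolding f_def \<eta>0_def Xe[symmetric] Ye[unfolded Xe[symmetric], symmetric] using Qp by (simp add: abs_mult)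
      also have "\<dots> = \<bar>\<xi>\<bar> / \<bar>\<eta>\<bar>" using Qp D_nonzero[of k] \<eta>n by (simp add: field_simps)
      finally show ?thesis .
    qed
    have w2: "w * w \<le> w / 100000" "0 < w * w" using w by auto
    have rbk: "r k * b k \<le> (11/10 * w) * (11/10 * w)" "0 \<le> r k * b k"
      using mult_mono[OF rb(2)[OF k] rb(4)[OF k]] rem_bounds[of k] b_bounds[of k] w by auto
    then have rbk': "r k * b k \<le> 1/100" using w2 w by linarith
    have d: "99/100 \<le> d" "d \<le> 101/100"
      unfolding d_def using rbk(2) rbk' eps_cases[of "Suc k"] by (auto simp: mult.assoc)
    have "\<bar>X\<bar> * \<bar>\<alpha> * X - Y\<bar> = \<bar>\<xi> * \<eta>\<bar> / d"
      unfolding product_eq_corner[of X Y k] by (simp add: corner_def x_def y_def \<xi>_def \<eta>_def d_def)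
    then have "\<bar>\<xi> * \<eta>\<bar> / d < c" using lt by simp
    then have "\<bar>\<xi> * \<eta>\<bar> < c * d" using d by (simp add: pos_divide_less_eq)
    also have "\<dots> \<le> (1/4) * (101/100)"
    proof (cases "0 \<le> c")
      case True
      then show ?thesis using c d by (intro mult_mono) auto
    next
      case False
      then have "c * d \<le> 0" using d by (intro mult_nonpos_nonneg) auto
      then show ?thesis by simp
    qed
    finally have xe: "\<bar>\<xi>\<bar> * \<bar>\<eta>\<bar> < 26/100" by (simp add: abs_mult)
    have f1: "w * \<bar>\<eta>\<bar> \<le> \<bar>\<xi>\<bar>" using fk(1) \<eta>n unfolding fe by (simp add: field_simps)
    \<comment> \<open>One level multiplies \<open>f\<close> by at least 81/100 w^2, so just before
      the crossing \<open>f k\<close> is at most 2 / w.\<close>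
    have f2: "w * \<bar>\<xi>\<bar> \<le> 2 * \<bar>\<eta>\<bar>"
    proof -
      have "(9/10 * w) * (9/10 * w) \<le> r k * b (Suc k)"
        using rb[OF k] rb[of "Suc k"] k w by (intro mult_mono) auto
      then have "f k * ((9/10 * w) * (9/10 * w)) \<le> f (Suc k)"
        unfolding f_Suc using fk(1) w by (intro mult_left_mono) auto
      then have "f k * ((9/10 * w) * (9/10 * w)) < w" using fk(2) by linarith
      then have "w * (f k * w * (81/100)) < w * 1" by (simp add: mult_ac)
      then have "f k * w * (81/100) < 1" using w by (simp only: mult_less_cancel_left_pos)
      then have "f k * w \<le> 2" by simp
      then show ?thesis using \<eta>n unfolding fe by (simp add: field_simps)
    qed
    \<comment> \<open>Here (w v)^2 = w (w v^2) <= w, so w v is at most the square root of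
      \<open>w\<close>. Hence the off-diagonal terms hardly change the coordinates, and
      \<open>x\<close>, \<open>y\<close> are close to \<xi>, \<eta>.\<close>
    have sm: "11/10 * w * v \<le> 1/100" if "0 \<le> v" "w * v * v \<le> 1" for v
    proof (rule ccontr)
      assume "\<not> 11/10 * w * v \<le> 1/100"
      then have "1/110 < w * v" by (simp add: mult.commute)
      then have "(1/110) * (1/110) < (w * v) * (w * v)" by (intro mult_strict_mono) auto
      also have "\<dots> = w * (w * v * v)" by simp
      also have "\<dots> \<le> w * 1" using that w by (intro mult_left_mono) auto
      finally show False using w by simp
    qed
    have "w * \<bar>\<eta>\<bar> * \<bar>\<eta>\<bar> \<le> 1"
      using mult_right_mono[OF f1, of "\<bar>\<eta>\<bar>"] xe by simp
    then have s1: "11/10 * w * \<bar>\<eta>\<bar> \<le> 1/100" by (intro sm) auto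
    have "w * \<bar>\<xi>\<bar> * \<bar>\<xi>\<bar> \<le> 1"
      using mult_right_mono[OF f2, of "\<bar>\<xi>\<bar>"] xe by (simp add: mult_ac)
    then have s2: "11/10 * w * \<bar>\<xi>\<bar> \<le> 1/100" by (intro sm) auto
    have "x * d = \<xi> - b k * \<eta>" "y * d = \<eta> + e (Suc k) * r k * \<xi>"
      unfolding \<xi>_def \<eta>_def d_def by (simp_all add: algebra_simps)
    moreover have "\<bar>b k * \<eta>\<bar> \<le> 1/100"
    proof -
      have "\<bar>b k * \<eta>\<bar> \<le> 11/10 * w * \<bar>\<eta>\<bar>"
        unfolding abs_mult using rb(3,4)[OF k] w by (intro mult_right_mono) auto
      then show ?thesis using s1 by linarith
    qed
    moreover have "\<bar>e (Suc k) * r k * \<xi>\<bar> \<le> 1/100"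
    proof -
      have "\<bar>e (Suc k) * r k * \<xi>\<bar> \<le> 11/10 * w * \<bar>\<xi>\<bar>"
        unfolding abs_mult eps_sq mult_1_left using rb(1,2)[OF k] w by (intro mult_right_mono) auto
      then show ?thesis using s2 by linarith
    qed
    ultimately have dx: "\<bar>x * d\<bar> - 1/100 \<le> \<bar>\<xi>\<bar>" and dy: "\<bar>y * d\<bar> - 1/100 \<le> \<bar>\<eta>\<bar>" by linarith+
    have x1: "\<bar>x\<bar> * (99/100) - 1/100 \<le> \<bar>\<xi>\<bar>" and y1: "\<bar>y\<bar> * (99/100) - 1/100 \<le> \<bar>\<eta>\<bar>"
      using dx dy mult_left_mono[OF d(1), of "\<bar>x\<bar>"] mult_left_mono[OF d(1), of "\<bar>y\<bar>"] d
      by (simp_all add: abs_mult)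
    note hf = half[OF k x_def[unfolded X Y] y_def[unfolded X Y]]
    have x2: "49/100 \<le> \<bar>x\<bar>" and y2: "49/100 \<le> \<bar>y\<bar>"
      using near_half_cases(1)[OF hf(1,2)] near_half_cases(1)[OF hf(3,4)] by auto
    \<comment> \<open>A coordinate beyond the four corners would make |\<xi>| |\<eta>| at least
      47/100, against \<open>xe\<close>.\<close>
    have "\<not> 149/100 \<le> \<bar>x\<bar>"
    proof
      assume "149/100 \<le> \<bar>x\<bar>"
      then have "1 * (47/100) \<le> \<bar>\<xi>\<bar> * \<bar>\<eta>\<bar>" using x1 y1 y2 by (intro mult_mono) linarith+
      then show False using xe by simp
    qed
    then obtain \<sigma> where \<sigma>: "\<sigma> \<in> {-1,1}" "x = \<sigma>/2 + e k * (S k - 1/2)"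
      using near_half_cases(2)[OF hf(1,2)] by blast
    have "\<not> 149/100 \<le> \<bar>y\<bar>"
    proof
      assume "149/100 \<le> \<bar>y\<bar>"
      then have "(47/100) * 1 \<le> \<bar>\<xi>\<bar> * \<bar>\<eta>\<bar>" using x1 y1 x2 by (intro mult_mono) linarith+
      then show False using xe by simp
    qed
    then obtain \<tau> where \<tau>: "\<tau> \<in> {-1,1}" "y = \<tau>/2 + (S (Suc k) - 1/2)"
      using near_half_cases(2)[OF hf(3,4)] by blast
    have "c \<le> corner (e (Suc k)) (r k) (b k) x y" using F[OF k \<sigma>(1) \<tau>(1)] \<sigma>(2) \<tau>(2) by simp
    then show False using lt unfolding product_eq_corner[of X Y k] x_def y_def by simp
  qed
  have \<gamma>: "\<gamma> \<notin> {of_int m + \<alpha> * of_int n | m n :: int. True}"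
  proof
    assume "\<gamma> \<in> {of_int m + \<alpha> * of_int n | m n :: int. True}"
    then obtain m n :: int where "\<gamma> = of_int m + \<alpha> * of_int n" by blast
    then show False using nz[of n "-m"] unfolding \<gamma>_def by (simp add: algebra_simps)
  qed
  \<comment> \<open>The three requirements on |n| ensure that |X| is at least |n| / 2, that the
    ratio at level \<open>K\<close> is at least \<open>w\<close> when
    \<open>N * \<eta> < 1/4\<close>, and that the displacement \<open>x0\<close> then costs at most
    \<delta>.\<close>
  define B where "B = Max {2 * \<bar>x0\<bar> + 1, w * Q (Suc K) / \<bar>D K\<bar>, \<bar>x0\<bar> / \<delta>}"
  have B: "2 * \<bar>x0\<bar> + 1 \<le> B" "w * Q (Suc K) / \<bar>D K\<bar> \<le> B" "\<bar>x0\<bar> / \<delta> \<le> B"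
    unfolding B_def by simp_all
  have "c - \<delta> \<le> \<bar>of_int n\<bar> * dist_nint (of_int n * \<alpha> - \<gamma>)" if n: "B \<le> \<bar>of_int n\<bar>" for n :: int
  proof -
    define N where "N = \<bar>real_of_int n\<bar>"
    define m where "m = round (of_int n * \<alpha> - \<gamma>)"
    define X Y where "X = x0 + of_int n" and "Y = y0 + of_int m"
    have N: "1 \<le> N" "2 * \<bar>x0\<bar> + 1 \<le> N" "w * Q (Suc K) / \<bar>D K\<bar> \<le> N" "\<bar>x0\<bar> / \<delta> \<le> N"
      using B n unfolding N_def by linarith+
    have di: "dist_nint (of_int n * \<alpha> - \<gamma>) = \<bar>\<alpha> * X - Y\<bar>"
      unfolding dist_nint_def m_def[symmetric] by (simp add: X_def Y_def \<gamma>_def algebra_simps)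
    define \<eta> where "\<eta> = \<bar>\<alpha> * X - Y\<bar>"
    have \<eta>: "0 < \<eta>" unfolding \<eta>_def X_def Y_def using nz by simp
    have XN: "N / 2 \<le> \<bar>X\<bar>" "\<bar>X\<bar> \<le> N + \<bar>x0\<bar>" unfolding X_def using N(2) unfolding N_def by linarith+
    have "c - \<delta> \<le> N * \<eta>"
    proof (cases "1/4 \<le> N * \<eta>")
      case True
      then show ?thesis using c \<delta> by linarith
    next
      case False
      have DK: "0 < \<bar>D K\<bar>" using D_nonzero by simp
      have QK: "0 < Q (Suc K)" using Q_mono(3)[of K] by linarith
      have "c \<le> \<bar>X\<bar> * \<bar>\<alpha> * X - Y\<bar>"
      proof (rule key[OF X_def Y_def])
        show "X \<noteq> 0" using XN N by auto
        have "w * Q (Suc K) \<le> N * \<bar>D K\<bar>" using N(3) DK by (simp add: field_simps)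
        then have "w * Q (Suc K) * \<eta> \<le> N * \<bar>D K\<bar> * \<eta>" using \<eta> by (intro mult_right_mono) auto
        also have "\<dots> = (N * \<eta>) * \<bar>D K\<bar>" by simp
        also have "\<dots> \<le> \<bar>X\<bar> * \<bar>D K\<bar>" using False XN N(1) DK by (intro mult_right_mono) linarith+
        finally show "w \<le> \<bar>X\<bar> * \<bar>D K\<bar> / (Q (Suc K) * \<bar>\<alpha> * X - Y\<bar>)"
          unfolding \<eta>_def[symmetric] using QK \<eta> by (simp add: field_simps)
      qed
      also have "\<dots> \<le> (N + \<bar>x0\<bar>) * \<eta>" unfolding \<eta>_def[symmetric] using XN \<eta> by (intro mult_right_mono) auto
      also have "\<dots> = N * \<eta> + \<bar>x0\<bar> * \<eta>" by (simp add: distrib_right)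
      also have "\<bar>x0\<bar> * \<eta> \<le> (N * \<delta>) * \<eta>"
        using N(4) \<delta> \<eta> by (intro mult_right_mono) (auto simp: field_simps)
      also have "(N * \<delta>) * \<eta> = (N * \<eta>) * \<delta>" by simp
      also have "\<dots> \<le> 1 * \<delta>" using False \<delta> by (intro mult_right_mono) auto
      finally show ?thesis by simp
    qed
    then show ?thesis unfolding di N_def \<eta>_def .
  qed
  then have "eventually (\<lambda>n. ereal (c - \<delta>) \<le> ereal (\<bar>of_int n\<bar> * dist_nint (of_int n * \<alpha> - \<gamma>)))
      (filtercomap (\<lambda>n::int. \<bar>n\<bar>) at_top)"
    unfolding eventually_filtercomap eventually_at_top_linorder ereal_less_eq
    by (intro exI[of _ "\<lambda>i. B \<le> of_int i"] conjI exI[of _ "\<lceil>B\<rceil>"]) (auto simp: ceiling_le_iff)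
  then have "ereal (c - \<delta>) \<le> inhom_M \<alpha> \<gamma>"
    unfolding inhom_M_def by (rule Liminf_bounded)
  then show ?thesis using \<gamma> by blast
qed

end

section \<open>The periodic expansion\<close>

text \<open>Since \<kappa>^2 = 1, the product of \<open>w - \<kappa> * w\<^sup>2\<close> and
  \<open>A + \<kappa>\<close> is 1 - w^2, so the error is exactly
  \<open>w\<^sup>2 / (A + \<kappa>)\<close>.\<close>

lemma inverse_offset:
  fixes A w \<kappa> :: real
  assumes w: "w = 1 / A" and A: "100000 \<le> A" and \<kappa>: "\<kappa> \<in> {-1, 1}"
  shows "\<bar>1 / (A + \<kappa>) - (w - \<kappa> * w\<^sup>2)\<bar> \<le> 2 * w^3"
proof -
  define B where "B = A + \<kappa>"
  have Aw: "A * w = 1" using w A by simp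
  have w0: "0 < w" "w \<le> 1/100000" unfolding w using A by (auto simp: field_simps)
  have B: "0 < B" using \<kappa> A unfolding B_def by auto
  have Bw: "B * w = 1 + \<kappa> * w" unfolding B_def distrib_right Aw ..
  have B2: "1 / B \<le> 2 * w" using Bw w0 \<kappa> B by (auto simp: field_simps)
  have sq: "\<kappa>\<^sup>2 = 1" using \<kappa> by auto
  have "(w - \<kappa> * w\<^sup>2) * B = (B * w) * (1 - \<kappa> * w)" by (simp add: algebra_simps power2_eq_square)
  also have "\<dots> = 1 - \<kappa>\<^sup>2 * w\<^sup>2" unfolding Bw by (simp add: algebra_simps power2_eq_square)
  finally have "(1 / B - (w - \<kappa> * w\<^sup>2)) * B = w\<^sup>2"
    unfolding sq using B by (simp add: left_diff_distrib)
  moreover have "x = y * (1 / z)" if "x * z = y" "0 < z" for x y z :: real using that by auto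
  ultimately have "1 / B - (w - \<kappa> * w\<^sup>2) = w\<^sup>2 * (1 / B)" using B by blast
  moreover have "w\<^sup>2 * (1 / B) \<le> w\<^sup>2 * (2 * w)" "0 \<le> w\<^sup>2 * (1 / B)"
    using mult_left_mono[OF B2, of "w\<^sup>2"] B by auto
  moreover have "w\<^sup>2 * (2 * w) = 2 * w^3" by (simp add: power2_eq_square power3_eq_cube)
  ultimately show ?thesis unfolding B_def by linarith
qed

text \<open>Applied with \<open>q\<close> a partial quotient and \<open>x\<close> its signed tail,
  for \<open>r\<close> and \<open>b\<close> alike: the result is within ten percent of
  \<open>w\<close>, and once the tail is O(w), dropping it costs only O(w^3).\<close>

lemma continued_fraction_step:
  fixes A w q x :: real
  assumes A: "100000 \<le> A" and w: "w = 1 / A" and q: "\<bar>q - A\<bar> \<le> 1"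
  shows "\<bar>x\<bar> \<le> 1 \<Longrightarrow> 9/10 * w \<le> 1 / (q + x)" "\<bar>x\<bar> \<le> 1 \<Longrightarrow> 1 / (q + x) \<le> 11/10 * w"
    "\<bar>x\<bar> \<le> 11/10 * w \<Longrightarrow> \<bar>1 / (q + x) - 1 / q\<bar> \<le> 2 * w^3"
proof -
  have w0: "0 < w" "w \<le> 1/100000" unfolding w using A by (auto simp: field_simps)
  have lo: "9/10 * w \<le> 1 / (q + y)" and up: "1 / (q + y) \<le> 11/10 * w" if "\<bar>y\<bar> \<le> 1" for y
  proof -
    have p: "0 < q + y" "q + y \<le> 10/9 * A" "10/11 * A \<le> q + y" using A q that by linarith+
    have Aw: "10/9 * A * (9/10 * w) = 1" "10/11 * A * (11/10 * w) = 1" unfolding w using A by auto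
    show "9/10 * w \<le> 1 / (q + y)" "1 / (q + y) \<le> 11/10 * w"
      using mult_right_mono[OF p(2), of "9/10 * w"] mult_right_mono[OF p(3), of "11/10 * w"] w0 p(1)
      unfolding Aw by (simp_all add: pos_le_divide_eq pos_divide_le_eq mult.commute)
  qed
  show "\<bar>x\<bar> \<le> 1 \<Longrightarrow> 9/10 * w \<le> 1 / (q + x)" "\<bar>x\<bar> \<le> 1 \<Longrightarrow> 1 / (q + x) \<le> 11/10 * w"
    using lo up by auto
  assume x: "\<bar>x\<bar> \<le> 11/10 * w"
  then have x1: "\<bar>x\<bar> \<le> 1" using w0 by linarith
  have pos: "0 < q + x" "0 < q" using A q x1 by linarith+
  have "1 / (q + x) - 1 / q = - (x * ((1 / (q + x)) * (1 / q)))" using pos by (simp add: field_simps)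
  then have "\<bar>1 / (q + x) - 1 / q\<bar> = \<bar>x * ((1 / (q + x)) * (1 / q))\<bar>" by (simp only: abs_minus_cancel)
  also have "\<dots> \<le> 11/10 * w * (11/10 * w * (11/10 * w))"
    unfolding abs_mult using x up[OF x1] up[of 0] pos w0 by (intro mult_mono) auto
  also have "\<dots> = 1331/1000 * w^3" by (simp add: power3_eq_cube)
  also have "\<dots> \<le> 2 * w^3" using w0 by simp
  finally show "\<bar>1 / (q + x) - 1 / q\<bar> \<le> 2 * w^3" .
qed

text \<open>One setting for both parities: the indexing is aligned so that the pair of odd quotients
  \<open>A\<close> comes first. The form at level \<open>k\<close> carries the sign
  \<open>e (Suc k)\<close>, so the levels \<open>4 * m + K\<close> and \<open>4 * m + K + 2\<close>
  are nodes and the other two are flat.\<close>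

locale nicf_block = nicf +
  fixes A B :: int and K :: nat and w \<kappa> :: real
  assumes w_eq: "w = 1 / of_int A" and A_ge: "100000 \<le> A" and A_odd: "odd A"
    and \<kappa>: "\<kappa> \<in> {-1, 1}" and B_eq: "of_int B = of_int A + \<kappa>"
    and rb_bounds: "\<And>k. K \<le> k \<Longrightarrow> 9/10 * w \<le> r k" "\<And>k. K \<le> k \<Longrightarrow> r k \<le> 11/10 * w"
      "\<And>k. K \<le> k \<Longrightarrow> 9/10 * w \<le> b k" "\<And>k. K \<le> k \<Longrightarrow> b k \<le> 11/10 * w"
    and eps: "\<And>m. e (4 * m + K) = 1" "\<And>m. e (Suc (4 * m + K)) = -1"
      "\<And>m. e (Suc (Suc (4 * m + K))) = 1" "\<And>m. e (Suc (Suc (Suc (4 * m + K)))) = -1"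
    and quot: "\<And>m. a (Suc (4 * m + K)) = A" "\<And>m. a (Suc (Suc (4 * m + K))) = A"
      "\<And>m. a (Suc (Suc (Suc (4 * m + K)))) = B" "\<And>m. a (Suc (Suc (Suc (Suc (4 * m + K))))) = B"
    and r_approx: "\<And>m. approx3 w 6 (r (4 * m + K)) 0 1 0" "\<And>m. approx3 w 6 (r (Suc (4 * m + K))) 0 1 0"
      "\<And>m. approx3 w 6 (r (Suc (Suc (4 * m + K)))) 0 1 (- \<kappa>)" "\<And>m. approx3 w 6 (r (Suc (Suc (Suc (4 * m + K))))) 0 1 (- \<kappa>)"
    and b_approx: "\<And>m. approx3 w 6 (b (4 * m + K)) 0 1 (- \<kappa>)" "\<And>m. approx3 w 6 (b (Suc (4 * m + K))) 0 1 0"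
      "\<And>m. approx3 w 6 (b (Suc (Suc (4 * m + K)))) 0 1 0" "\<And>m. approx3 w 6 (b (Suc (Suc (Suc (4 * m + K))))) 0 1 (- \<kappa>)"
begin

lemma w_bounds: "0 < w" "w \<le> 1/100000" and A_w: "of_int A * w = 1"
proof -
  have "real_of_int A \<ge> 100000" using A_ge by simp
  then show "0 < w" "w \<le> 1/100000" "of_int A * w = 1" unfolding w_eq by (auto simp: field_simps)
qed

lemma w_powers: "0 < w\<^sup>2" "w\<^sup>2 \<le> w / 100000" "0 < w^3" "w^3 \<le> w\<^sup>2 / 100000"
  using w_bounds by (auto simp: power2_eq_square power3_eq_cube intro: mult_left_mono)

lemma B_pos: "0 < real_of_int B" and B_even: "even B" and B_w: "of_int B * w = 1 + \<kappa> * w"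
  and inverse_B: "\<bar>1 / of_int B - (w - \<kappa> * w\<^sup>2)\<bar> \<le> 2 * w^3"
proof -
  have A: "real_of_int A \<ge> 100000" using A_ge by simp
  show "0 < real_of_int B" using B_eq \<kappa> A by auto
  have "B = A + 1 \<or> B = A - 1" using B_eq \<kappa> by (auto; linarith)
  then show "even B" using A_odd by auto
  show "of_int B * w = 1 + \<kappa> * w" unfolding B_eq distrib_right A_w ..
  show "\<bar>1 / of_int B - (w - \<kappa> * w\<^sup>2)\<bar> \<le> 2 * w^3"
    unfolding B_eq by (rule inverse_offset[OF w_eq A \<kappa>])
qed

lemma inverse_B_coarse: "\<bar>1 / of_int B - w\<bar> \<le> 2 * w\<^sup>2" "0 < 1 / real_of_int B" "1 / real_of_int B \<le> 2 * w"
proof -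
  have "\<bar>\<kappa> * w\<^sup>2\<bar> = w\<^sup>2" using \<kappa> by auto
  then show c: "\<bar>1 / of_int B - w\<bar> \<le> 2 * w\<^sup>2" using inverse_B w_powers by linarith
  show "0 < 1 / real_of_int B" using B_pos by simp
  show "1 / real_of_int B \<le> 2 * w" using c w_powers by linarith
qed

lemma eps_next: "e (Suc (Suc (Suc (Suc (4 * m + K))))) = 1"
proof -
  have "4 * Suc m + K = Suc (Suc (Suc (Suc (4 * m + K))))" by simp
  then show ?thesis using eps(1)[of "Suc m"] by (simp only:)
qed

lemma flat_gap:
  "\<bar>b (Suc (4 * m + K)) - r (Suc (4 * m + K))\<bar> \<le> w\<^sup>2"
  "\<bar>b (Suc (Suc (Suc (4 * m + K)))) - r (Suc (Suc (Suc (4 * m + K))))\<bar> \<le> w\<^sup>2"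
  using r_approx(2,4)[of m] b_approx(2,4)[of m] w_powers unfolding approx3_def by linarith+

lemma rb_coarse:
  assumes "K \<le> k"
  shows "0 \<le> r k" "r k \<le> 2 * w" "0 \<le> b k" "b k \<le> 2 * w"
  using rb_bounds[OF assms] w_bounds by linarith+

text \<open>For odd R, with w = 1/R and \<kappa> = 1, this is the claimed value itself; for even R,
  with w = 1/(R+1) and \<kappa> = -1, it agrees with the claimed value up to O(1/R^3).\<close>

definition main_term :: real where "main_term = 1/4 - 3/4 * w + (3 + 2 * \<kappa>) / 4 * w\<^sup>2"

text \<open>Supplies the first order value of an outer neighbour, as
  \<open>block_node_coordinates\<close> requires of \<open>u\<close> and \<open>v\<close>.\<close>

lemma neighbour_A:
  assumes "of_int A * u = h + x" "\<bar>x\<bar> \<le> 10 * w"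
  shows "\<bar>u - h * w\<bar> \<le> 30 * w\<^sup>2"
proof -
  have "u = w * (h + x)" using assms(1) A_w by (metis mult.assoc mult.commute mult_1)
  then have "u - h * w = w * x" by (simp add: algebra_simps)
  moreover have "\<bar>w * x\<bar> \<le> w * (10 * w)" unfolding abs_mult using assms(2) w_bounds by (intro mult_mono) auto
  ultimately show ?thesis using w_powers by (simp add: power2_eq_square)
qed

lemma neighbour_B:
  assumes "of_int B * u = h + x" "\<bar>x\<bar> \<le> 10 * w" "\<bar>h\<bar> \<le> 1"
  shows "\<bar>u - h * w\<bar> \<le> 30 * w\<^sup>2"
proof -
  define i where "i = 1 / real_of_int B"
  have "u = i * (h + x)" using assms(1) B_pos unfolding i_def by (simp add: field_simps)
  then have "u - h * w = (i - w) * h + i * x" by (simp add: algebra_simps)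
  moreover have "\<bar>(i - w) * h\<bar> \<le> 2 * w\<^sup>2 * 1"
    unfolding abs_mult using inverse_B_coarse assms(3) by (intro mult_mono) (auto simp: i_def)
  moreover have "\<bar>i * x\<bar> \<le> 2 * w * (10 * w)"
    unfolding abs_mult using inverse_B_coarse assms(2) w_bounds by (intro mult_mono) (auto simp: i_def)
  ultimately show ?thesis using w_powers by (simp add: power2_eq_square)
qed

lemma block_node_coordinates:
  assumes p: "of_int B * p = g - v - z" and z: "of_int A * z = h + u - p"
    and c: "\<bar>g\<bar> \<le> 1" "\<bar>h\<bar> \<le> 1" "\<bar>h'\<bar> \<le> 1" "\<bar>v1\<bar> \<le> 1"
    and bnd: "\<bar>p\<bar> \<le> 5 * w" "\<bar>z\<bar> \<le> 5 * w"
    and u: "\<bar>u - h' * w\<bar> \<le> 30 * w\<^sup>2" and v: "\<bar>v - v1 * w\<bar> \<le> 30 * w\<^sup>2"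
  shows "approx3 w 60 p 0 g (- g * \<kappa> - v1 - h)" "approx3 w 60 z 0 h (h' - g)"
proof -
  have p': "p = 1 / of_int B * (g - v - z)" using p B_pos by (simp add: field_simps)
  have z': "z = w * (h + u - p)" using z A_w by (metis mult.assoc mult.commute mult_1)
  have k: "\<bar>\<kappa>\<bar> \<le> 1" using \<kappa> by auto
  have w': "w \<le> 1/1000" using w_bounds by linarith
  show "approx3 w 60 p 0 g (- g * \<kappa> - v1 - h)" "approx3 w 60 z 0 h (h' - g)"
    using node_coordinates[OF w_bounds(1) w' c k inverse_B p' z' bnd u v] by auto
qed

section \<open>Upper bound for every grid\<close>

lemma inhom_M_upper:
  assumes \<gamma>: "\<gamma> \<notin> {of_int m + \<alpha> * of_int n | m n :: int. True}"
  shows "inhom_M \<alpha> \<gamma> \<le> ereal (main_term + 2000000000 * w^3)"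
proof (rule ccontr)
  \<comment> \<open>The error constant is twice that of \<open>node_upper\<close>, so every
    application of that lemma contradicts \<open>c\<close>.\<close>
  define c where "c = main_term + 2000000000 * w^3"
  assume "\<not> ?thesis"
  then have "ereal c < inhom_M \<alpha> \<gamma>" unfolding c_def by simp
  from corner_ge_of_less_inhom_M[OF \<gamma> this] obtain k0 where k0:
    "\<And>k x y. k0 \<le> k \<Longrightarrow> x - e k * coord 0 \<gamma> k \<in> \<int> \<Longrightarrow> y - coord 0 \<gamma> (Suc k) \<in> \<int> \<Longrightarrow>
      \<bar>x\<bar> \<le> 1 \<Longrightarrow> \<bar>y\<bar> \<le> 1 \<Longrightarrow> c \<le> corner (e (Suc k)) (r k) (b k) x y"
    by blast
  \<comment> \<open>The shift of the grid from 1/2, normalised to absolute value at most 1/2;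
    \<open>level_bound\<close> then improves this to 5w.\<close>
  define s where "s k = frac (coord 0 \<gamma> k) - 1/2" for k
  have s_half: "\<bar>s k\<bar> \<le> 1/2" for k
    using frac_ge_0[of "coord 0 \<gamma> k"] frac_lt_1[of "coord 0 \<gamma> k"] unfolding s_def by linarith
  have s_int: "1/2 + s k - coord 0 \<gamma> k \<in> \<int>" for k
    by (simp add: s_def frac_def)
  have cs: "(3 + 2 * \<kappa>) / 4 * w\<^sup>2 \<ge> 0" using \<kappa> w_powers by auto
  have c_ge: "1/4 - 3/4 * w \<le> c"
    using cs w_powers unfolding c_def main_term_def by linarith
  have corners: "c \<le> corner (e (Suc k)) (r k) (b k) (\<sigma>/2 + e k * s k) (\<tau>/2 + s (Suc k))"
    if "k0 \<le> k" "\<sigma> \<in> {-1,1}" "\<tau> \<in> {-1,1}" for k \<sigma> \<tau>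
  proof (rule k0[OF that(1)])
    have "\<sigma>/2 + e k * s k - e k * coord 0 \<gamma> k = (\<sigma> - e k) / 2 + e k * (1/2 + s k - coord 0 \<gamma> k)"
      by (simp add: field_simps)
    moreover have "(\<sigma> - e k) / 2 \<in> \<int>" using that(2) eps_cases[of k] by auto
    ultimately show "\<sigma>/2 + e k * s k - e k * coord 0 \<gamma> k \<in> \<int>"
      using s_int[of k] by (auto simp del: coord.simps intro!: Ints_add Ints_mult)
    have "\<tau>/2 + s (Suc k) - coord 0 \<gamma> (Suc k) = (\<tau> - 1) / 2 + (1/2 + s (Suc k) - coord 0 \<gamma> (Suc k))"
      by (simp add: field_simps)
    moreover have "(\<tau> - 1) / 2 \<in> \<int>" using that(3) by auto
    ultimately show "\<tau>/2 + s (Suc k) - coord 0 \<gamma> (Suc k) \<in> \<int>"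
      using s_int[of "Suc k"] by (metis Ints_add)
    have "\<bar>e k * s k\<bar> \<le> 1/2" using s_half[of k] by (simp add: abs_mult eps_sq)
    then show "\<bar>\<sigma>/2 + e k * s k\<bar> \<le> 1" using that(2) by auto
    show "\<bar>\<tau>/2 + s (Suc k)\<bar> \<le> 1" using that(3) s_half[of "Suc k"] by auto
  qed
  have s5: "\<bar>s k\<bar> \<le> 5 * w" if k: "k0 \<le> k" "K \<le> k" for k
  proof -
    have "\<bar>e k * s k\<bar> \<le> 5 * w"
    proof (rule level_bound(1)[OF w_bounds _ rb_bounds(2)[OF k(2)] _ rb_bounds(4)[OF k(2)] eps_sq(2) c_ge])
      show "\<bar>e k * s k\<bar> \<le> 1/2" using s_half[of k] by (simp add: abs_mult eps_sq)
    qed (use rb_coarse[OF k(2)] s_half[of "Suc k"] corners[OF k(1)] in auto)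
    then show ?thesis by (simp add: abs_mult eps_sq)
  qed
  \<comment> \<open>The relations of the introduction solved for the \<open>h\<^sub>j\<close>. The
    index is off by one: \<open>s k\<close> stands for \<open>s\<^sub>-\<^sub>1\<close> and
    \<open>s (Suc k)\<close> for \<open>s\<^sub>0\<close>.\<close>
  define h0 where "h0 k = of_int A * s (Suc k) - s (Suc (Suc k)) + s k" for k
  define h1 where "h1 k = of_int A * s (Suc (Suc k)) + s (Suc k) + s (Suc (Suc (Suc k)))" for k
  define h2 where "h2 k = of_int B * s (Suc (Suc (Suc k))) + s (Suc (Suc k)) - s (Suc (Suc (Suc (Suc k))))" for k
  define h3 where "h3 k = of_int B * s (Suc (Suc (Suc (Suc k)))) + s (Suc (Suc (Suc k))) + s (Suc (Suc (Suc (Suc (Suc k)))))" for k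
  define good where "good k \<longleftrightarrow> k0 \<le> k \<and> (\<exists>m. k = 4 * m + K)" for k
  have good_K: "k0 \<le> k" "K \<le> k" if "good k" for k using that unfolding good_def by auto
  have good_Suc: "good (k + 4)" if "good k" for k
    using that unfolding good_def by (auto intro: exI[of _ "Suc _"])
  \<comment> \<open>Parity enters here: measuring the coordinates from 1/2 leaves A/2 or B/2 modulo
    integers, which is half-odd for \<open>A\<close> and integral for \<open>B\<close>.\<close>
  have h01_int: "h0 k - 1/2 \<in> \<int>" "h1 k - 1/2 \<in> \<int>" and h23_int: "h2 k \<in> \<int>" "h3 k \<in> \<int>" if "good k" for k
  proof -
    obtain m where m: "k = 4 * m + K" using \<open>good k\<close> unfolding good_def by blast
    define d where "d k = 1/2 + s k - coord 0 \<gamma> k" for k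
    have d: "d k \<in> \<int>" for k unfolding d_def by (rule s_int)
    have sd: "s k = d k + coord 0 \<gamma> k - 1/2" for k unfolding d_def by simp
    have c: "coord 0 \<gamma> (Suc (Suc k)) = coord 0 \<gamma> k + A * coord 0 \<gamma> (Suc k)"
      "coord 0 \<gamma> (Suc (Suc (Suc k))) = - coord 0 \<gamma> (Suc k) - A * coord 0 \<gamma> (Suc (Suc k))"
      "coord 0 \<gamma> (Suc (Suc (Suc (Suc k)))) = coord 0 \<gamma> (Suc (Suc k)) + B * coord 0 \<gamma> (Suc (Suc (Suc k)))"
      "coord 0 \<gamma> (Suc (Suc (Suc (Suc (Suc k))))) = - coord 0 \<gamma> (Suc (Suc (Suc k))) - B * coord 0 \<gamma> (Suc (Suc (Suc (Suc k))))"
      unfolding m by (simp_all add: eps[of m] eps_next[of m] quot[of m])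
    obtain i j where i: "A = 2 * i + 1" and j: "B = 2 * j" using A_odd B_even by (auto elim!: oddE evenE)
    have "h0 k - 1/2 = A * d (Suc k) - d (Suc (Suc k)) + d k - of_int (i + 1)"
      unfolding h0_def sd c i by (simp add: field_simps)
    then show "h0 k - 1/2 \<in> \<int>" using d by (auto intro!: Ints_add Ints_diff Ints_mult)
    have "h1 k - 1/2 = A * d (Suc (Suc k)) + d (Suc k) + d (Suc (Suc (Suc k))) - of_int (i + 2)"
      unfolding h1_def sd c(2) i by (simp add: field_simps)
    then show "h1 k - 1/2 \<in> \<int>" using d by (auto intro!: Ints_add Ints_diff Ints_mult)
    have "h2 k = B * d (Suc (Suc (Suc k))) + d (Suc (Suc k)) - d (Suc (Suc (Suc (Suc k)))) - of_int j"
      unfolding h2_def sd c(3) j by (simp add: field_simps)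
    then show "h2 k \<in> \<int>" using d by (auto intro!: Ints_add Ints_diff Ints_mult)
    have "h3 k = B * d (Suc (Suc (Suc (Suc k)))) + d (Suc (Suc (Suc k))) + d (Suc (Suc (Suc (Suc (Suc k))))) - of_int (j + 1)"
      unfolding h3_def sd c(4) j by (simp add: field_simps)
    then show "h3 k \<in> \<int>" using d by (auto intro!: Ints_add Ints_diff Ints_mult)
  qed
  have s5': "\<bar>s k\<bar> \<le> 5 * w" "\<bar>s (Suc k)\<bar> \<le> 5 * w" "\<bar>s (Suc (Suc k))\<bar> \<le> 5 * w" "\<bar>s (Suc (Suc (Suc k)))\<bar> \<le> 5 * w"
    "\<bar>s (Suc (Suc (Suc (Suc k))))\<bar> \<le> 5 * w" "\<bar>s (Suc (Suc (Suc (Suc (Suc k)))))\<bar> \<le> 5 * w" if "good k" for k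
    using good_K[OF that] by (auto intro!: s5)
  \<comment> \<open>Multiplied by \<open>A\<close> or \<open>B\<close>, the flat bound 3/2 w becomes
    about 3/2 for the sum of two of the |h|. With generous rounding it is 11/10 * 16/10 = 176/100,
    still below 2.\<close>
  have scale: "\<bar>x\<bar> + \<bar>y\<bar> < 2"
    if "\<bar>x - of_int n * u\<bar> \<le> 10 * w" "\<bar>y - of_int n * v\<bar> \<le> 10 * w" "\<bar>u\<bar> + \<bar>v\<bar> \<le> 3/2 * w + 200 * w\<^sup>2"
      "0 \<le> of_int n * w" "of_int n * w \<le> 11/10" for x y u v and n :: int
  proof -
    have n0: "0 \<le> real_of_int n" using that(4) w_bounds by (simp add: zero_le_mult_iff)
    have "of_int n * (\<bar>u\<bar> + \<bar>v\<bar>) \<le> of_int n * (w * (16/10))"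
      using that(3) w_powers by (intro mult_left_mono n0) linarith
    also have "\<dots> \<le> 11/10 * (16/10)" using that(5) by (simp add: mult.commute)
    finally have "\<bar>of_int n * u\<bar> + \<bar>of_int n * v\<bar> \<le> 176/100"
      using n0 by (simp add: abs_mult distrib_left)
    moreover have "\<bar>x\<bar> \<le> \<bar>of_int n * u\<bar> + 10 * w" "\<bar>y\<bar> \<le> \<bar>of_int n * v\<bar> + 10 * w"
      using that(1,2) by linarith+
    ultimately show ?thesis using w_bounds by linarith
  qed
  have h01: "h0 k \<in> {-1/2, 1/2}" "h1 k \<in> {-1/2, 1/2}" if g: "good k" for k
  proof -
    obtain m where m: "k = 4 * m + K" using g unfolding good_def by blast
    have "\<bar>- s (Suc k)\<bar> + \<bar>s (Suc (Suc k))\<bar> \<le> 3/2 * w + 200 * w\<^sup>2"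
    proof (rule flat_upper[OF w_bounds, of "r (Suc k)" "b (Suc k)" _ _ c])
      show "\<bar>b (Suc k) - r (Suc k)\<bar> \<le> w\<^sup>2" unfolding m by (rule flat_gap)
      show "c \<le> corner 1 (r (Suc k)) (b (Suc k)) (\<sigma>/2 + - s (Suc k)) (\<tau>/2 + s (Suc (Suc k)))"
        if "\<sigma> \<in> {-1,1}" "\<tau> \<in> {-1,1}" for \<sigma> \<tau>
        using corners[OF _ that, of "Suc k"] good_K[OF g] eps[of m] unfolding m by simp
    qed (use rb_coarse[of "Suc k"] good_K[OF g] s5'[OF g] c_ge in auto)
    then have f: "\<bar>s (Suc k)\<bar> + \<bar>s (Suc (Suc k))\<bar> \<le> 3/2 * w + 200 * w\<^sup>2" by simp
    have "\<bar>h0 k - of_int A * s (Suc k)\<bar> \<le> 10 * w"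
      using s5'(1,3)[OF g] unfolding h0_def by linarith
    moreover have "\<bar>h1 k - of_int A * s (Suc (Suc k))\<bar> \<le> 10 * w"
      using s5'(2,4)[OF g] unfolding h1_def by linarith
    ultimately have "\<bar>h0 k\<bar> + \<bar>h1 k\<bar> < 2"
      using f by (rule scale) (simp_all add: A_w)
    then show "h0 k \<in> {-1/2, 1/2}" "h1 k \<in> {-1/2, 1/2}"
      using half_odd_pair h01_int[OF g] by blast+
  qed
  have h23: "h2 k \<in> {-1, 1} \<and> h3 k = 0 \<or> h3 k \<in> {-1, 1} \<and> h2 k = 0 \<or> h2 k = 0 \<and> h3 k = 0" if g: "good k" for k
  proof -
    obtain m where m: "k = 4 * m + K" using g unfolding good_def by blast
    have "\<bar>- s (Suc (Suc (Suc k)))\<bar> + \<bar>s (Suc (Suc (Suc (Suc k))))\<bar> \<le> 3/2 * w + 200 * w\<^sup>2"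
    proof (rule flat_upper[OF w_bounds, of "r (Suc (Suc (Suc k)))" "b (Suc (Suc (Suc k)))" _ _ c])
      show "\<bar>b (Suc (Suc (Suc k))) - r (Suc (Suc (Suc k)))\<bar> \<le> w\<^sup>2" unfolding m by (rule flat_gap)
      show "c \<le> corner 1 (r (Suc (Suc (Suc k)))) (b (Suc (Suc (Suc k)))) (\<sigma>/2 + - s (Suc (Suc (Suc k)))) (\<tau>/2 + s (Suc (Suc (Suc (Suc k)))))"
        if "\<sigma> \<in> {-1,1}" "\<tau> \<in> {-1,1}" for \<sigma> \<tau>
        using corners[OF _ that, of "Suc (Suc (Suc k))"] good_K[OF g] eps[of m] eps_next[of m] unfolding m by simp
    qed (use rb_coarse[of "Suc (Suc (Suc k))"] good_K[OF g] s5'[OF g] c_ge in auto)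
    then have f: "\<bar>s (Suc (Suc (Suc k)))\<bar> + \<bar>s (Suc (Suc (Suc (Suc k))))\<bar> \<le> 3/2 * w + 200 * w\<^sup>2" by simp
    have "\<bar>h2 k - of_int B * s (Suc (Suc (Suc k)))\<bar> \<le> 10 * w"
      using s5'(3,5)[OF g] unfolding h2_def by linarith
    moreover have "\<bar>h3 k - of_int B * s (Suc (Suc (Suc (Suc k))))\<bar> \<le> 10 * w"
      using s5'(4,6)[OF g] unfolding h3_def by linarith
    ultimately have "\<bar>h2 k\<bar> + \<bar>h3 k\<bar> < 2"
      using f by (rule scale) (use w_bounds \<kappa> in \<open>auto simp: B_w\<close>)
    then show ?thesis using int_pair h23_int[OF g] by blast
  qed
  have gap: "\<not> c \<le> 1/4 - 3/4 * w + (3 + 2 * \<kappa>) / 4 * w\<^sup>2 + 1000000000 * w^3"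
    using w_powers unfolding c_def main_term_def by linarith
  \<comment> \<open>The second node is the mirror image of the first one, with \<open>(h\<^sub>0, h\<^sub>1)\<close> replaced by \<open>(h\<^sub>1, -h\<^sub>0)\<close>. So exactly one
    of them falls under the case \<open>h' = h\<close> of \<open>node_upper\<close> when \<open>h\<^sub>2\<close> and \<open>h\<^sub>3\<close> vanish.\<close>
  have first_node: False
    if g: "good k" and v0: "h2 k = 0" and h3: "h3 k \<in> {-1, 1} \<or> h3 k = 0 \<and> h1 (k + 4) = h0 (k + 4)" for k
  proof -
    \<comment> \<open>This node joins two periods: \<open>p\<close> belongs to the last
      \<open>B\<close> of one, so \<open>g\<close> is \<open>h3 k\<close>, and \<open>z\<close> to
      the first \<open>A\<close> of the next, so \<open>h\<close> is \<open>h0 l\<close>.\<close>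
    define l where "l = k + 4"
    have gl: "good l" unfolding l_def by (rule good_Suc[OF g])
    obtain m where m: "l = 4 * m + K" using gl unfolding good_def by blast
    have lS: "l = Suc (Suc (Suc (Suc k)))" unfolding l_def by simp
    note b1 = s5'[OF g] and b2 = s5'[OF gl]
    have h: "\<bar>h0 l\<bar> \<le> 1" "\<bar>h1 l\<bar> \<le> 1" "\<bar>h3 k\<bar> \<le> 1" using h01[OF gl] h3 by auto
    have u: "\<bar>s (Suc (Suc l)) - h1 l * w\<bar> \<le> 30 * w\<^sup>2"
      by (rule neighbour_A[of _ _ "- s (Suc l) - s (Suc (Suc (Suc l)))"])
         (use b2 in \<open>auto simp: h1_def\<close>)
    have "\<bar>s (Suc (Suc (Suc k))) - h2 k * w\<bar> \<le> 30 * w\<^sup>2"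
      by (rule neighbour_B[of _ _ "s l - s (Suc (Suc k))"])
         (use b1 v0 in \<open>auto simp: lS h2_def\<close>)
    then have v: "\<bar>s (Suc (Suc (Suc k))) - 0 * w\<bar> \<le> 30 * w\<^sup>2" using v0 by simp
    have ap: "approx3 w 60 (s l) 0 (h3 k) (- h3 k * \<kappa> - 0 - h0 l)" "approx3 w 60 (s (Suc l)) 0 (h0 l) (h1 l - h3 k)"
      by (rule block_node_coordinates[OF _ _ h(3,1,2) _ b2(1,2) u v]; simp add: h3_def h0_def lS)+
    show False
    proof (rule notE[OF gap], rule node_upper[OF w_bounds h01[OF gl] _ \<kappa> _ ap(2) b_approx(1)[of m] r_approx(1)[of m]])
      show "h3 k \<in> {-1, 1} \<or> h3 k = 0 \<and> h1 l = h0 l" using h3 unfolding l_def .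
      show "approx3 w 60 (s l) 0 (h3 k) (- h3 k * \<kappa> - h0 l)" using ap(1) by simp
      show "c \<le> corner (-1) (r (4 * m + K)) (b (4 * m + K)) (\<sigma>/2 + s l) (\<tau>/2 + s (Suc l))"
        if "\<sigma> \<in> {-1,1}" "\<tau> \<in> {-1,1}" for \<sigma> \<tau>
        using corners[OF good_K(1)[OF gl] that] eps[of m] unfolding m by simp
    qed
  qed
  have second_node: False
    if g: "good k" and v0: "h3 k = 0" and h2: "h2 k \<in> {-1, 1} \<or> h2 k = 0 \<and> - h0 k = h1 k" for k
  proof -
    obtain m where m: "k = 4 * m + K" using g unfolding good_def by blast
    note b1 = s5'[OF g]
    have h: "\<bar>h1 k\<bar> \<le> 1" "\<bar>- h0 k\<bar> \<le> 1" "\<bar>h2 k\<bar> \<le> 1" using h01[OF g] h2 by auto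
    \<comment> \<open>The mirror reverses the order of the shifts: the outer neighbours enter with a
      minus sign, and \<open>corner_swap\<close> exchanges \<open>r\<close> and
      \<open>b\<close>.\<close>
    have u: "\<bar>- s (Suc k) - (- h0 k) * w\<bar> \<le> 30 * w\<^sup>2"
      by (rule neighbour_A[of _ _ "- s (Suc (Suc k)) + s k"])
         (use b1 in \<open>auto simp: h0_def\<close>)
    have "\<bar>s (Suc (Suc (Suc (Suc k)))) - h3 k * w\<bar> \<le> 30 * w\<^sup>2"
      by (rule neighbour_B[of _ _ "- s (Suc (Suc (Suc k))) - s (Suc (Suc (Suc (Suc (Suc k)))))"])
         (use b1 v0 in \<open>auto simp: h3_def\<close>)
    then have v: "\<bar>- s (Suc (Suc (Suc (Suc k)))) - 0 * w\<bar> \<le> 30 * w\<^sup>2" using v0 by simp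
    have ap: "approx3 w 60 (s (Suc (Suc (Suc k)))) 0 (h2 k) (- h2 k * \<kappa> - 0 - h1 k)"
      "approx3 w 60 (s (Suc (Suc k))) 0 (h1 k) (- h0 k - h2 k)"
      by (rule block_node_coordinates[OF _ _ h(3,1,2) _ b1(4,3) u v]; simp add: h2_def h1_def)+
    have hh: "- h0 k \<in> {-1/2, 1/2}" using h01[OF g] by auto
    show False
    proof (rule notE[OF gap], rule node_upper[OF w_bounds h01(2)[OF g] hh h2 \<kappa> _ ap(2) r_approx(3)[of m] b_approx(3)[of m]])
      show "approx3 w 60 (s (Suc (Suc (Suc k)))) 0 (h2 k) (- h2 k * \<kappa> - h1 k)" using ap(1) by simp
      show "c \<le> corner (-1) (b (Suc (Suc (4 * m + K)))) (r (Suc (Suc (4 * m + K)))) (\<sigma>/2 + s (Suc (Suc (Suc k)))) (\<tau>/2 + s (Suc (Suc k)))"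
        if "\<sigma> \<in> {-1,1}" "\<tau> \<in> {-1,1}" for \<sigma> \<tau>
        using corners[OF _ that(2,1), of "Suc (Suc k)"] good_K[OF g] eps[of m]
        unfolding m by (subst corner_swap) simp
    qed
  qed
  have "good (4 * k0 + K)" unfolding good_def by auto
  then obtain k where g: "good k" by blast
  \<comment> \<open>At most one of \<open>h2\<close>, \<open>h3\<close> is nonzero, and a nonzero
    one is excluded at the node where it plays the role of \<open>g\<close>.\<close>
  have zero: "h2 k = 0 \<and> h3 k = 0" if "good k" for k
    using h23[OF that] first_node[OF that] second_node[OF that] by blast
  have g4: "good (k + 4)" by (rule good_Suc[OF g])
  show False
  proof (cases "h1 (k + 4) = h0 (k + 4)")
    case True
    then show False using first_node[OF g] zero[OF g] by blast
  next
    case False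
    then have "- h0 (k + 4) = h1 (k + 4)" using h01[OF g4] by auto
    then show False using second_node[OF g4] zero[OF g4] by blast
  qed
qed

text \<open>The equations decouple in terms of \<open>mm = s0 + s2\<close> and \<open>pp = s1 - s3\<close>.\<close>

lemma periodic_solution:
  assumes g: "g \<in> {0, 1::real}"
  obtains s0 s1 s2 s3 where
    "of_int A * s0 = 1/2 + s1 - s3" "of_int A * s1 = 1/2 + - s0 - s2"
    "of_int B * s2 = 0 - - s3 - s1" "of_int B * s3 = g - s2 - s0"
    "\<bar>s0\<bar> \<le> 2 * w" "\<bar>s1\<bar> \<le> 2 * w" "\<bar>s2\<bar> \<le> 2 * w" "\<bar>s3\<bar> \<le> 2 * w"
proof -
  define i where "i = 1 / real_of_int B"
  define d where "d = w - i"
  define V where "V = w / 2 - g * i"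
  \<comment> \<open>Cramer's rule for \<open>mm = w / 2 + d * pp\<close>,
    \<open>pp = V - d * mm\<close>, whose determinant is 1 + d^2.\<close>
  define mm where "mm = (w / 2 + d * V) / (1 + d\<^sup>2)"
  define pp where "pp = (V - d * (w / 2)) / (1 + d\<^sup>2)"
  have i: "0 < i" "i \<le> 11/10 * w" "\<bar>d\<bar> \<le> w" "of_int B * i = 1"
    using inverse_B_coarse w_powers w_bounds B_pos unfolding i_def d_def by (simp_all; linarith)+
  have d0: "0 < 1 + d\<^sup>2" by (simp add: add_pos_nonneg)
  have mm: "mm = w / 2 + d * pp" and pp: "pp = V - d * mm"
    unfolding mm_def pp_def using d0 by (simp_all add: field_simps power2_eq_square)
  have V: "\<bar>V\<bar> \<le> 2 * w" using g i w_bounds unfolding V_def by auto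
  have q: "\<bar>x / (1 + d\<^sup>2)\<bar> \<le> \<bar>x\<bar>" for x
    using d0 mult_left_mono[of 1 "1 + d\<^sup>2" "\<bar>x\<bar>"] by (simp add: abs_divide pos_divide_le_eq)
  have "\<bar>d * V\<bar> \<le> w * (2 * w)" "\<bar>d * (w/2)\<bar> \<le> w * w"
    unfolding abs_mult using i(3) V w_bounds by (intro mult_mono; simp)+
  moreover have "w * w \<le> w" using w_bounds by simp
  ultimately have mb: "\<bar>mm\<bar> \<le> 1/2" and pb: "\<bar>pp\<bar> \<le> 1/2"
    using q[of "w / 2 + d * V"] q[of "V - d * (w / 2)"] V w_bounds unfolding mm_def pp_def by linarith+
  define s0 s1 s2 s3 where "s0 = w * (1/2 + pp)" and "s1 = w * (1/2 - mm)" and "s2 = - i * pp" and "s3 = i * (g - mm)"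
  have p: "s1 - s3 = pp" unfolding s1_def s3_def pp V_def d_def by (simp add: algebra_simps)
  have m: "s0 + s2 = mm" unfolding s0_def s2_def mm d_def by (simp add: algebra_simps)
  have "of_int A * s0 = (of_int A * w) * (1/2 + pp)" "of_int A * s1 = (of_int A * w) * (1/2 - mm)"
    "of_int B * s2 = (of_int B * i) * (- pp)" "of_int B * s3 = (of_int B * i) * (g - mm)"
    unfolding s0_def s1_def s2_def s3_def by simp_all
  then have r: "of_int A * s0 = 1/2 + s1 - s3" "of_int A * s1 = 1/2 + - s0 - s2"
    "of_int B * s2 = 0 - - s3 - s1" "of_int B * s3 = g - s2 - s0"
    unfolding A_w i(4) p[symmetric] m[symmetric] by simp_all
  have t: "\<bar>x * y\<bar> \<le> 2 * w" if "0 \<le> x" "x \<le> 11/10 * w" "\<bar>y\<bar> \<le> 3/2" for x y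
  proof -
    have "\<bar>x * y\<bar> \<le> 11/10 * w * (3/2)" unfolding abs_mult using that w_bounds by (intro mult_mono) auto
    then show ?thesis using w_bounds by linarith
  qed
  have "\<bar>s0\<bar> \<le> 2 * w" "\<bar>s1\<bar> \<le> 2 * w" "\<bar>s3\<bar> \<le> 2 * w"
    unfolding s0_def s1_def s3_def using mb pb i w_bounds g by (intro t; auto)+
  moreover have "\<bar>s2\<bar> \<le> 2 * w" using t[of i pp] pb i unfolding s2_def by auto
  ultimately show ?thesis using that r by blast
qed

section \<open>Lower bound from the periodic grid\<close>

lemma level_cases:
  assumes "K \<le> k"
  obtains m where "k = 4 * m + K" | m where "k = Suc (4 * m + K)"
    | m where "k = Suc (Suc (4 * m + K))" | m where "k = Suc (Suc (Suc (4 * m + K)))"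
proof -
  define m where "m = (k - K) div 4"
  have "k = 4 * m + (k - K) mod 4 + K" unfolding m_def using assms by simp
  moreover have "(k - K) mod 4 < 4" by simp
  ultimately consider "k = 4 * m + K" | "k = Suc (4 * m + K)" | "k = Suc (Suc (4 * m + K))" | "k = Suc (Suc (Suc (4 * m + K)))"
    by linarith
  then show ?thesis using that by cases auto
qed

lemma inhom_M_lower:
  "\<exists>\<gamma>. \<gamma> \<notin> {of_int m + \<alpha> * of_int n | m n :: int. True} \<and> ereal (main_term - 2000000000 * w^3) \<le> inhom_M \<alpha> \<gamma>"
proof -
  \<comment> \<open>The extremal value of \<open>h\<^sub>3\<close>; the other three are 1/2, 1/2, 0
    for both signs of \<kappa>.\<close>
  define g :: real where "g = (if \<kappa> = 1 then 1 else 0)"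
  have g01: "g \<in> {0,1}" unfolding g_def by simp
  obtain s0 s1 s2 s3 where rel: "of_int A * s0 = 1/2 + s1 - s3" "of_int A * s1 = 1/2 + - s0 - s2"
    "of_int B * s2 = 0 - - s3 - s1" "of_int B * s3 = g - s2 - s0"
    and bnd: "\<bar>s0\<bar> \<le> 2 * w" "\<bar>s1\<bar> \<le> 2 * w" "\<bar>s2\<bar> \<le> 2 * w" "\<bar>s3\<bar> \<le> 2 * w"
    using periodic_solution[OF g01] .
  have n0: "\<bar>s0 - 1/2 * w\<bar> \<le> 30 * w\<^sup>2" and n1: "\<bar>s1 - 1/2 * w\<bar> \<le> 30 * w\<^sup>2"
    by (rule neighbour_A[of _ _ "s1 - s3"], use rel bnd w_bounds in linarith, use bnd w_bounds in linarith)
       (rule neighbour_A[of _ _ "- s0 - s2"], use rel bnd w_bounds in linarith, use bnd w_bounds in linarith)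
  have n2: "\<bar>s2 - 0 * w\<bar> \<le> 30 * w\<^sup>2"
    by (rule neighbour_B[of _ _ "s3 - s1"]) (use rel bnd w_bounds in auto)
  have n3: "\<bar>s3 - g * w\<bar> \<le> 30 * w\<^sup>2"
    by (rule neighbour_B[of _ _ "- s2 - s0"]) (use rel bnd w_bounds g01 in auto)
  \<comment> \<open>The levels run one index ahead of the shifts: level \<open>4 * m + K\<close>
    carries \<open>s3\<close>, and \<open>s0\<close> follows at the next one.\<close>
  define T where "T j = (if j = 0 then s3 else if j = 1 then s0 else if j = 2 then s1 else s2)" for j :: nat
  define S where "S k = 1/2 + T ((k - K) mod 4)" for k
  have S: "S (4 * m + K) - 1/2 = s3" "S (Suc (4 * m + K)) - 1/2 = s0" "S (Suc (Suc (4 * m + K))) - 1/2 = s1"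
    "S (Suc (Suc (Suc (4 * m + K)))) - 1/2 = s2" "S (Suc (Suc (Suc (Suc (4 * m + K))))) - 1/2 = s3"
    "S (Suc (Suc (Suc (Suc (Suc (4 * m + K)))))) - 1/2 = s0" for m
  proof -
    have "S (4 * n + j + K) - 1/2 = T j" if "j < 4" for n j :: nat
      using that unfolding S_def by simp
    from this[of 0 m] this[of 1 m] this[of 2 m] this[of 3 m] this[of 0 "Suc m"] this[of 1 "Suc m"]
    show "S (4 * m + K) - 1/2 = s3" "S (Suc (4 * m + K)) - 1/2 = s0" "S (Suc (Suc (4 * m + K))) - 1/2 = s1"
      "S (Suc (Suc (Suc (4 * m + K)))) - 1/2 = s2" "S (Suc (Suc (Suc (Suc (4 * m + K))))) - 1/2 = s3"
      "S (Suc (Suc (Suc (Suc (Suc (4 * m + K)))))) - 1/2 = s0"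
      by (simp_all add: T_def numeral_eq_Suc)
  qed
  have S': "S (4 * m + K) = 1/2 + s3" "S (Suc (4 * m + K)) = 1/2 + s0" "S (Suc (Suc (4 * m + K))) = 1/2 + s1"
    "S (Suc (Suc (Suc (4 * m + K)))) = 1/2 + s2" "S (Suc (Suc (Suc (Suc (4 * m + K))))) = 1/2 + s3"
    "S (Suc (Suc (Suc (Suc (Suc (4 * m + K)))))) = 1/2 + s0" for m
    using S[of m] by linarith+
  obtain i j where ij: "A = 2 * i + 1" "B = 2 * j" using A_odd B_even by (auto elim!: oddE evenE)
  have ij': "real_of_int A = 2 * of_int i + 1" "real_of_int B = 2 * of_int j" using ij by simp_all
  \<comment> \<open>\<open>node_lower\<close> uses up half of the allowed error; the \<delta> of
    \<open>inhom_M_ge\<close> will be w^3.\<close>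
  define c where "c = main_term - 1000000000 * w^3"
  have ks: "(3 + 2 * \<kappa>) / 4 * w\<^sup>2 \<le> 5/4 * w\<^sup>2" using \<kappa> by (intro mult_right_mono) auto
  have c_le: "c \<le> 1/4 - 3/4 * w + 5/4 * w\<^sup>2"
    using ks w_powers unfolding c_def main_term_def by linarith
  \<comment> \<open>The two nodes of a period. The second is read in mirror order, whence
    \<open>h'\<close> = -1/2 and the outer value -g.\<close>
  have tuple: "(\<kappa>, 1/2, 1/2, g, 0) \<in> {(-1, 1/2, 1/2, 0, 0), (-1, 1/2, -1/2, 0, 0), (1, 1/2, 1/2, 1, 0), (1, 1/2, -1/2, 0, -1::real)}"
    "(\<kappa>, 1/2, -1/2, 0, - g) \<in> {(-1, 1/2, 1/2, 0, 0), (-1, 1/2, -1/2, 0, 0), (1, 1/2, 1/2, 1, 0), (1, 1/2, -1/2, 0, -1::real)}"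
    using \<kappa> unfolding g_def by auto
  have b5: "\<bar>s0\<bar> \<le> 5 * w" "\<bar>s1\<bar> \<le> 5 * w" "\<bar>s2\<bar> \<le> 5 * w" "\<bar>s3\<bar> \<le> 5 * w" using bnd w_bounds by linarith+
  have g1: "\<bar>g\<bar> \<le> 1" "\<bar>- g\<bar> \<le> 1" "\<bar>1/2::real\<bar> \<le> 1" "\<bar>-1/2::real\<bar> \<le> 1" "\<bar>0::real\<bar> \<le> 1" using g01 by auto
  have "- s0 - (-1/2) * w = - (s0 - 1/2 * w)" by simp
  then have n0': "\<bar>- s0 - (-1/2) * w\<bar> \<le> 30 * w\<^sup>2" using n0 by (simp only: abs_minus_cancel)
  have "- s3 - (- g) * w = - (s3 - g * w)" by simp
  then have n3': "\<bar>- s3 - (- g) * w\<bar> \<le> 30 * w\<^sup>2" using n3 by (simp only: abs_minus_cancel)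
  note ap0 = block_node_coordinates[OF rel(4) rel(1) g1(1) g1(3) g1(3) g1(5) b5(4) b5(1) n1 n2]
  note ap2 = block_node_coordinates[OF rel(3) rel(2) g1(5) g1(3) g1(4) g1(2) b5(3) b5(2) n0' n3']
  have "\<exists>\<gamma>. \<gamma> \<notin> {of_int m + \<alpha> * of_int n | m n :: int. True} \<and> ereal (c - w^3) \<le> inhom_M \<alpha> \<gamma>"
  proof (rule inhom_M_ge[OF w_bounds _ _ rb_bounds, where S = S and K = K])
    fix k assume "K \<le> k"
    then show "S (Suc (Suc k)) - (e k * S k - e (Suc k) * a (Suc k) * S (Suc k)) \<in> \<int>"
    proof (cases k rule: level_cases)
      case (1 m)
      have "S (Suc (Suc k)) - (e k * S k - e (Suc k) * a (Suc k) * S (Suc k)) = of_int (- i - 1)"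
        using rel(1) unfolding 1 S' eps[of m] quot[of m] by (simp add: ij' field_simps)
      then show ?thesis by (simp only: Ints_of_int)
    next
      case (2 m)
      have "S (Suc (Suc k)) - (e k * S k - e (Suc k) * a (Suc k) * S (Suc k)) = of_int (i + 2)"
        using rel(2) unfolding 2 S' eps[of m] quot[of m] by (simp add: ij' field_simps)
      then show ?thesis by (simp only: Ints_of_int)
    next
      case (3 m)
      have "S (Suc (Suc k)) - (e k * S k - e (Suc k) * a (Suc k) * S (Suc k)) = of_int (- j)"
        using rel(3) unfolding 3 S' eps[of m] quot[of m] by (simp add: ij' field_simps)
      then show ?thesis by (simp only: Ints_of_int)
    next
      case (4 m)
      have "S (Suc (Suc k)) - (e k * S k - e (Suc k) * a (Suc k) * S (Suc k)) = of_int (1 + j) + g"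
        using rel(4) unfolding 4 S' eps[of m] eps_next[of m] quot[of m] by (simp add: ij' field_simps)
      moreover have "g \<in> \<int>" using g01 by auto
      ultimately show ?thesis by (simp only: Ints_of_int Ints_add)
    qed
  next
    fix k assume "K \<le> k"
    then show "\<bar>S k - 1/2\<bar> \<le> 2 * w"
      by (cases k rule: level_cases) (simp_all only: S bnd)
  next
    fix k and \<sigma> \<tau> :: real
    assume k: "K \<le> k" and st: "\<sigma> \<in> {-1,1}" "\<tau> \<in> {-1,1}"
    from k show "c \<le> corner (e (Suc k)) (r k) (b k) (\<sigma>/2 + e k * (S k - 1/2)) (\<tau>/2 + (S (Suc k) - 1/2))"
    proof (cases k rule: level_cases)
      case (1 m)
      show ?thesis
        using node_lower[OF w_bounds tuple(1) ap0 b_approx(1)[of m] r_approx(1)[of m] st]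
        unfolding 1 S eps[of m] c_def main_term_def by simp
    next
      case (2 m)
      have "\<bar>- s0\<bar> + \<bar>s1\<bar> \<le> 5/4 * w" using n0 n1 w_powers w_bounds by linarith
      from flat_lower[OF w_bounds rb_coarse(1,2) rb_coarse(3,4) flat_gap(1)[of m] this st]
      show ?thesis using c_le unfolding 2 S eps[of m] by simp
    next
      case (3 m)
      show ?thesis
        using node_lower[OF w_bounds tuple(2) ap2 r_approx(3)[of m] b_approx(3)[of m] st(2,1)]
        unfolding 3 S eps[of m] c_def main_term_def by (subst (asm) corner_swap) simp
    next
      case (4 m)
      have "g * w \<le> w" "0 \<le> g * w" using g01 w_bounds by auto
      then have "\<bar>- s2\<bar> + \<bar>s3\<bar> \<le> 5/4 * w" using n2 n3 w_powers w_bounds by linarith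
      from flat_lower[OF w_bounds rb_coarse(1,2) rb_coarse(3,4) flat_gap(2)[of m] this st]
      show ?thesis using c_le unfolding 4 S eps[of m] eps_next[of m] by simp
    qed
  next
    show "c \<le> 1/4" using c_le w_powers w_bounds by linarith
    show "0 < w^3" by (rule w_powers)
  qed
  moreover have "ereal (main_term - 2000000000 * w^3) \<le> ereal (c - w^3)"
    unfolding c_def using w_powers by simp
  ultimately show ?thesis using order_trans by blast
qed

section \<open>Bounds for the supremum and alignment of the period\<close>

lemma inhom_rho_bounds:
  "ereal (main_term - 2000000000 * w^3) \<le> inhom_rho \<alpha>" "inhom_rho \<alpha> \<le> ereal (main_term + 2000000000 * w^3)"
proof -
  obtain \<gamma> where \<gamma>: "\<gamma> \<notin> {of_int m + \<alpha> * of_int n | m n :: int. True}"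
    "ereal (main_term - 2000000000 * w^3) \<le> inhom_M \<alpha> \<gamma>"
    using inhom_M_lower by blast
  show "ereal (main_term - 2000000000 * w^3) \<le> inhom_rho \<alpha>"
    unfolding inhom_rho_def by (rule Sup_upper2[OF _ \<gamma>(2)]) (use \<gamma>(1) in blast)
  show "inhom_rho \<alpha> \<le> ereal (main_term + 2000000000 * w^3)"
    unfolding inhom_rho_def by (rule Sup_least) (use inhom_M_upper in blast)
qed

end

text \<open>An empty supremum in the extended reals would be minus infinity, so an admissible
  \<gamma> is needed; 1/2 is one because \<alpha> is irrational.\<close>

lemma (in nicf) inhom_rho_coarse: "ereal 0 \<le> inhom_rho \<alpha>" "inhom_rho \<alpha> \<le> ereal 2"
proof -
  have "1/2 \<notin> {of_int m + \<alpha> * of_int n | m n :: int. True}"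
  proof
    assume "1/2 \<in> {of_int m + \<alpha> * of_int n | m n :: int. True}"
    then obtain m n :: int where mn: "1/2 = of_int m + \<alpha> * of_int n" by blast
    show False
    proof (cases "n = 0")
      case True
      then have "real_of_int (2 * m) = 1" using mn by simp
      then have "2 * m = 1" by linarith
      then show False by presburger
    next
      case False
      then have "\<alpha> = (1/2 - of_int m) / of_int n" using mn by (simp add: field_simps)
      then show False using irrational by (metis Rats_diff Rats_divide Rats_number_of Rats_of_int Rats_1)
    qed
  qed
  moreover have "ereal 0 \<le> inhom_M \<alpha> (1/2)"
    unfolding inhom_M_def by (intro Liminf_bounded always_eventually) (simp add: dist_nint_nonneg)
  ultimately show "ereal 0 \<le> inhom_rho \<alpha>"
    unfolding inhom_rho_def by (intro Sup_upper2[of "inhom_M \<alpha> (1/2)"]) blast+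
  show "inhom_rho \<alpha> \<le> ereal 2"
    unfolding inhom_rho_def by (rule Sup_least) (use inhom_M_le_2 in blast)
qed

text \<open>The block starts one period later, at \<open>K + 4\<close>, because the estimates of
  \<open>b\<close> look backwards and need earlier quotients that already belong to the
  period.\<close>

lemma (in nicf) block_of_period:
  fixes A B :: int and \<kappa> :: real
  assumes A: "100000 \<le> A" "odd A" and \<kappa>: "\<kappa> \<in> {-1, 1}" "of_int B = of_int A + \<kappa>"
    and eps: "\<And>m. e (4 * m + K + 1) = -1" "\<And>m. e (4 * m + K + 2) = 1" "\<And>m. e (4 * m + K + 3) = -1" "\<And>m. e (4 * m + K + 4) = 1"
    and quot: "\<And>m. a (4 * m + K + 1) = A" "\<And>m. a (4 * m + K + 2) = A" "\<And>m. a (4 * m + K + 3) = B" "\<And>m. a (4 * m + K + 4) = B"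
  shows "nicf_block \<alpha> A B (K + 4) (1 / of_int A) \<kappa>"
proof -
  define w where "w = 1 / real_of_int A"
  have Ar: "100000 \<le> real_of_int A" using A(1) by simp
  have w0: "0 < w" "w \<le> 1/100000" unfolding w_def using Ar by (auto simp: field_simps)
  note step = continued_fraction_step[OF Ar w_def]
  have near: "\<bar>real_of_int (a (Suc k)) - of_int A\<bar> \<le> 1" if "K \<le> k" for k
  proof -
    define m where "m = (k - K) div 4"
    have "k = 4 * m + (k - K) mod 4 + K" unfolding m_def using that by simp
    moreover have "(k - K) mod 4 < 4" by simp
    ultimately consider "Suc k = 4 * m + K + 1" | "Suc k = 4 * m + K + 2" | "Suc k = 4 * m + K + 3" | "Suc k = 4 * m + K + 4"
      by linarith
    then have "a (Suc k) = A \<or> a (Suc k) = B" by cases (simp_all only: quot simp_thms)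
    then show ?thesis using \<kappa> by auto
  qed
  have r_eq: "r k = 1 / (a (Suc k) + e (Suc (Suc k)) * r (Suc k))" for k
  proof -
    have "r k = 1 / (1 / r k)" by simp
    then show ?thesis unfolding inverse_rem .
  qed
  have er: "\<bar>e j * r k\<bar> = r k" and eb: "\<bar>e j * b k\<bar> = b k" for j k
    using rem_bounds[of k] b_bounds[of k] by (simp_all add: abs_mult eps_sq)
  have rb: "9/10 * w \<le> r k" "r k \<le> 11/10 * w" if "K \<le> k" for k
    using step(1,2)[OF near[OF that], of "e (Suc (Suc k)) * r (Suc k)"] rem_bounds[of "Suc k"] r_eq[of k]
    by (auto simp: er)
  have bb: "9/10 * w \<le> b (Suc k)" "b (Suc k) \<le> 11/10 * w" if "K \<le> k" for k
    using step(1,2)[OF near[OF that], of "e (Suc k) * b k"] b_bounds[of k] b_Suc[of k]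
    by (auto simp: eb)
  have ra: "\<bar>r k - 1 / a (Suc k)\<bar> \<le> 2 * w^3" if "K \<le> k" for k
    using step(3)[OF near[OF that], of "e (Suc (Suc k)) * r (Suc k)"] rb(2)[of "Suc k"] that r_eq[of k]
    by (simp add: er)
  have ba: "\<bar>b (Suc (Suc k)) - 1 / a (Suc (Suc k))\<bar> \<le> 2 * w^3" if "K \<le> k" for k
    using step(3)[OF near[of "Suc k"], of "e (Suc (Suc k)) * b (Suc k)"] bb(2)[OF that] that b_Suc[of "Suc k"]
    by (simp add: eb)
  have w3: "0 \<le> w^3" using w0 by simp
  have apA: "approx3 w 6 x 0 1 0" if "\<bar>x - 1 / real_of_int A\<bar> \<le> 2 * w^3" for x
    using that w3 unfolding approx3_def w_def[symmetric] by simp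
  have apB: "approx3 w 6 x 0 1 (- \<kappa>)" if "\<bar>x - 1 / real_of_int B\<bar> \<le> 2 * w^3" for x
    using that w3 inverse_offset[OF w_def Ar \<kappa>(1)] unfolding approx3_def \<kappa>(2) by auto
  have e': "e (4 * m + (K + 4)) = 1" "e (Suc (4 * m + (K + 4))) = -1"
      "e (Suc (Suc (4 * m + (K + 4)))) = 1" "e (Suc (Suc (Suc (4 * m + (K + 4))))) = -1" for m
    using eps(4)[of m] eps(1-3)[of "Suc m"] by (simp_all add: eval_nat_numeral)
  have a': "a (4 * m + (K + 4)) = B" "a (Suc (4 * m + (K + 4))) = A" "a (Suc (Suc (4 * m + (K + 4)))) = A"
      "a (Suc (Suc (Suc (4 * m + (K + 4))))) = B" "a (Suc (Suc (Suc (Suc (4 * m + (K + 4)))))) = B" for m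
    using quot(4)[of m] quot[of "Suc m"] by (simp_all add: eval_nat_numeral)
  have b0: "\<bar>b (4 * m + (K + 4)) - 1 / a (4 * m + (K + 4))\<bar> \<le> 2 * w^3" for m
    using ba[of "4 * m + K + 2"] by (simp add: eval_nat_numeral)
  show ?thesis unfolding w_def[symmetric]
  proof unfold_locales
    show "w = 1 / real_of_int A" by (rule w_def)
    show "9/10 * w \<le> b k" "b k \<le> 11/10 * w" if "K + 4 \<le> k" for k
      using bb[of "k - 1"] that by (cases k; auto)+
    show "approx3 w 6 (r (4 * m + (K + 4))) 0 1 0" "approx3 w 6 (r (Suc (4 * m + (K + 4)))) 0 1 0" for m
      by (rule apA, use ra[of "4 * m + (K + 4)"] a'[of m] in simp)
         (rule apA, use ra[of "Suc (4 * m + (K + 4))"] a'[of m] in simp)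
    show "approx3 w 6 (r (Suc (Suc (4 * m + (K + 4))))) 0 1 (- \<kappa>)" "approx3 w 6 (r (Suc (Suc (Suc (4 * m + (K + 4)))))) 0 1 (- \<kappa>)" for m
      by (rule apB, use ra[of "Suc (Suc (4 * m + (K + 4)))"] a'[of m] in simp)
         (rule apB, use ra[of "Suc (Suc (Suc (4 * m + (K + 4))))"] a'[of m] in simp)
    show "approx3 w 6 (b (4 * m + (K + 4))) 0 1 (- \<kappa>)" for m
      by (rule apB) (use b0[of m] a'[of m] in simp)
    show "approx3 w 6 (b (Suc (4 * m + (K + 4)))) 0 1 0" for m
      by (rule apA) (use ba[of "4 * m + K + 3"] a'[of m] in \<open>simp add: eval_nat_numeral\<close>)
    show "approx3 w 6 (b (Suc (Suc (4 * m + (K + 4))))) 0 1 0" for m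
      by (rule apA) (use ba[of "4 * m + (K + 4)"] a'[of m] in simp)
    show "approx3 w 6 (b (Suc (Suc (Suc (4 * m + (K + 4)))))) 0 1 (- \<kappa>)" for m
      by (rule apB) (use ba[of "Suc (4 * m + (K + 4))"] a'[of m] in simp)
  qed (use A \<kappa> rb e' a' in auto)
qed

lemma (in nicf) signed_quotient:
  assumes "nicf_signed \<alpha> i = v" "v \<noteq> 0"
  shows "e i = sgn v" "a i = \<bar>v\<bar>" "i \<noteq> 0"
proof -
  show "i \<noteq> 0"
  proof
    assume "i = 0"
    then show False using assms by (simp add: nicf_signed_def)
  qed
  then obtain k where "i = Suc k" by (cases i) auto
  then have "a i \<ge> 2" using partial_quotient_ge_2 by simp
  then show "e i = sgn v" "a i = \<bar>v\<bar>"
    using assms eps_cases[of i] by (auto simp: nicf_signed_def)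
qed

text \<open>For odd R the period is taken as given; for even R it is entered halfway, at -(R+1), so
  that the odd quotient comes first.\<close>

lemma (in nicf) block_of_signed_period:
  fixes R :: int
  assumes R: "100000 \<le> R" and per: "eventually_periodic_with [- R, R, - (R + 1), R + 1] (nicf_signed \<alpha>)"
  shows "odd R \<Longrightarrow> \<exists>K. nicf_block \<alpha> R (R + 1) K (1 / of_int R) 1"
    "even R \<Longrightarrow> \<exists>K. nicf_block \<alpha> (R + 1) R K (1 / of_int (R + 1)) (-1)"
proof -
  obtain N where N: "\<And>k. nicf_signed \<alpha> (N + k) = [- R, R, - (R + 1), R + 1] ! (k mod 4)"
    using per unfolding eventually_periodic_with_def by auto
  have M: "nicf_signed \<alpha> (4 * m + N + j) = [- R, R, - (R + 1), R + 1] ! j" if "j < 4" for m j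
  proof -
    have "(4 * m + j) mod 4 = j" using that by simp
    then show ?thesis using N[of "4 * m + j"] by (metis add.assoc add.commute)
  qed
  have s: "nicf_signed \<alpha> (4 * m + N) = - R" "nicf_signed \<alpha> (4 * m + N + 1) = R"
    "nicf_signed \<alpha> (4 * m + N + 2) = - (R + 1)" "nicf_signed \<alpha> (4 * m + N + 3) = R + 1" for m
    using M[of 0 m] M[of 1 m] M[of 2 m] M[of 3 m] by simp_all
  have nz: "- R \<noteq> 0" "R \<noteq> 0" "- (R + 1) \<noteq> 0" "R + 1 \<noteq> 0" using R by auto
  have sg: "sgn (- R) = -1" "sgn R = 1" "sgn (- (R + 1)) = -1" "sgn (R + 1) = 1"
    "\<bar>- R\<bar> = R" "\<bar>R\<bar> = R" "\<bar>- (R + 1)\<bar> = R + 1" "\<bar>R + 1\<bar> = R + 1" using R by auto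
  note ea = signed_quotient[OF s(1) nz(1), unfolded sg] signed_quotient[OF s(2) nz(2), unfolded sg]
    signed_quotient[OF s(3) nz(3), unfolded sg] signed_quotient[OF s(4) nz(4), unfolded sg]
  \<comment> \<open>The period cannot begin at index 0, where the signed quotient is 0, so there is
    an index before it.\<close>
  obtain N' where N': "N = Suc N'" using ea(3)[of 0] by (cases N) auto
  show "\<exists>K. nicf_block \<alpha> R (R + 1) K (1 / of_int R) 1" if "odd R"
    by (rule exI, rule block_of_period[where K = N'])
       (use R that ea in \<open>simp_all add: N' eval_nat_numeral\<close>)
  show "\<exists>K. nicf_block \<alpha> (R + 1) R K (1 / of_int (R + 1)) (-1)" if "even R"
    by (rule exI, rule block_of_period[where K = "N + 1"])
       (use R that ea ea(1,2,4,5)[of "Suc _"] in \<open>simp_all add: eval_nat_numeral\<close>)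
qed

section \<open>Both parities and the small values of R\<close>

lemma ereal_abs_diff_le:
  assumes "ereal l \<le> x" "x \<le> ereal u" "t - c \<le> l" "u \<le> t + c"
  shows "\<bar>x - ereal t\<bar> \<le> ereal c"
proof -
  obtain y where y: "x = ereal y" using assms(1,2) by (cases x) auto
  then show ?thesis using assms by auto
qed

text \<open>Passing from 1/(R+1) to 1/R, the term -3w/4 contributes another 3/4 in second order;
  with the 1/4 already present this gives 1/R^2, the source of the 4 in the even case.\<close>

lemma even_case_expansion:
  fixes R w :: real
  assumes R: "100000 \<le> R" and w: "w = 1 / (R + 1)"
  shows "\<bar>(1/4 - 3/4 * w + 1/4 * w\<^sup>2) - 1/4 * (1 - 3 / R + 4 / R\<^sup>2)\<bar> \<le> 2 / R^3" "w^3 \<le> 1 / R^3" "0 \<le> w^3"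
proof -
  have R0: "0 < R" using R by simp
  have "(1/4 - 3/4 * w + 1/4 * w\<^sup>2) - 1/4 * (1 - 3 / R + 4 / R\<^sup>2) = - ((5 * R + 4) / (4 * R\<^sup>2 * (R + 1)\<^sup>2))"
    unfolding w using R0 by (simp add: divide_simps power2_eq_square) (simp add: algebra_simps)
  moreover have "(5 * R + 4) / (4 * R\<^sup>2 * (R + 1)\<^sup>2) \<le> 2 / R^3"
  proof -
    have "(5 * R + 4) * R^3 \<le> 2 * (4 * R\<^sup>2 * (R + 1)\<^sup>2)"
      using R0 by (simp add: algebra_simps power2_eq_square power3_eq_cube)
    then show ?thesis using R0 by (simp add: frac_le_eq pos_divide_le_eq field_simps)
  qed
  moreover have "0 \<le> (5 * R + 4) / (4 * R\<^sup>2 * (R + 1)\<^sup>2)" using R0 by simp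
  ultimately show "\<bar>(1/4 - 3/4 * w + 1/4 * w\<^sup>2) - 1/4 * (1 - 3 / R + 4 / R\<^sup>2)\<bar> \<le> 2 / R^3" by linarith
  have "w^3 \<le> (1 / R)^3" unfolding w using R0 by (intro power_mono) (auto simp: field_simps)
  then show "w^3 \<le> 1 / R^3" by (simp add: power_divide)
  show "0 \<le> w^3" unfolding w using R0 by simp
qed

theorem theorem2:
  "\<exists>C::real. C > 0 \<and>
    (\<forall>R::int. \<forall>\<alpha>::real.
      R \<ge> 2 \<longrightarrow> \<alpha> \<notin> \<rat> \<longrightarrow> 0 < \<alpha> \<longrightarrow> \<alpha> < 1 / 2 \<longrightarrow>
      eventually_periodic_with [- R, R, - (R + 1), R + 1] (nicf_signed \<alpha>) \<longrightarrow>
      (even R \<longrightarrow>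
         \<bar>inhom_rho \<alpha> - ereal (1 / 4 * (1 - 3 / of_int R + 4 / (of_int R)\<^sup>2))\<bar>
           \<le> ereal (C / of_int R ^ 3)) \<and>
      (odd R \<longrightarrow>
         \<bar>inhom_rho \<alpha> - ereal (1 / 4 * (1 - 3 / of_int R + 5 / (of_int R)\<^sup>2))\<bar>
           \<le> ereal (C / of_int R ^ 3)))"
proof (intro exI[of _ "10000000000000000"] conjI allI impI)
  fix R :: int and \<alpha> :: real
  assume R: "R \<ge> 2" and \<alpha>: "\<alpha> \<notin> \<rat>" "0 < \<alpha>" "\<alpha> < 1 / 2"
    and per: "eventually_periodic_with [- R, R, - (R + 1), R + 1] (nicf_signed \<alpha>)"
  interpret nicf \<alpha> by unfold_locales (fact \<alpha>)+
  \<comment> \<open>For these R the constant makes the claim trivial: R^3 <= 10^15, so C/R^3 >= 10,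
    while \<open>inhom_rho_coarse\<close> confines rho to [0, 2].\<close>
  have small: "\<bar>inhom_rho \<alpha> - ereal (1 / 4 * (1 - 3 / of_int R + x / (of_int R)\<^sup>2))\<bar> \<le> ereal (10000000000000000 / of_int R ^ 3)"
    if "R < 100000" "x \<in> {4, 5}" for x :: real
  proof -
    have R2: "2 \<le> real_of_int R" "real_of_int R \<le> 100000" using R that(1) by auto
    have "real_of_int R ^ 3 \<le> 100000 ^ 3" using R2 by (intro power_mono) auto
    then have "10 \<le> 10000000000000000 / real_of_int R ^ 3" using R2 by (simp add: pos_le_divide_eq)
    moreover have "0 \<le> 3 / real_of_int R" "3 / real_of_int R \<le> 2" using R2 by (auto simp: field_simps)
    moreover have "4 \<le> (real_of_int R)\<^sup>2" using power_mono[of 2 "real_of_int R" 2] R2 by simp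
    then have "0 \<le> x / (real_of_int R)\<^sup>2" "x / (real_of_int R)\<^sup>2 \<le> 2"
      using that(2) R2 by (auto simp: pos_divide_le_eq)
    moreover have "1 / 4 * (1 - X + Y) - Z \<le> 0 \<and> 2 \<le> 1 / 4 * (1 - X + Y) + Z"
      if "10 \<le> Z" "0 \<le> X" "X \<le> 2" "0 \<le> Y" "Y \<le> 2" for X Y Z :: real
      using that by (simp add: field_simps)
    ultimately show ?thesis
      by (intro ereal_abs_diff_le[OF inhom_rho_coarse]) blast+
  qed
  have R3: "0 < real_of_int R ^ 3" using R by simp
  {
    assume "even R"
    show "\<bar>inhom_rho \<alpha> - ereal (1 / 4 * (1 - 3 / of_int R + 4 / (of_int R)\<^sup>2))\<bar> \<le> ereal (10000000000000000 / of_int R ^ 3)"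
    proof (cases "R < 100000")
      case False
      obtain K where "nicf_block \<alpha> (R + 1) R K (1 / of_int (R + 1)) (-1)"
        using block_of_signed_period(2)[OF _ per \<open>even R\<close>] False by auto
      then interpret nicf_block \<alpha> "R + 1" R K "1 / of_int (R + 1)" "-1" .
      define w where "w = 1 / (real_of_int R + 1)"
      have ex: "\<bar>(1/4 - 3/4 * w + 1/4 * w\<^sup>2) - 1/4 * (1 - 3 / of_int R + 4 / (of_int R)\<^sup>2)\<bar> \<le> 2 / of_int R^3"
        "w^3 \<le> 1 / of_int R^3"
        using even_case_expansion[OF _ w_def] False by auto
      have bnd: "ereal ((1/4 - 3/4 * w + 1/4 * w\<^sup>2) - 2000000000 * w^3) \<le> inhom_rho \<alpha>"
        "inhom_rho \<alpha> \<le> ereal ((1/4 - 3/4 * w + 1/4 * w\<^sup>2) + 2000000000 * w^3)"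
        using inhom_rho_bounds unfolding main_term_def w_def by simp_all
      have "10000000000000000 / real_of_int R^3 = 10000000000000000 * (1 / of_int R^3)" "2 / real_of_int R^3 = 2 * (1 / of_int R^3)" by simp_all
      then show ?thesis
        using ex R3 by (intro ereal_abs_diff_le[OF bnd]) linarith+
    qed (use small in simp)
  next
    assume "odd R"
    show "\<bar>inhom_rho \<alpha> - ereal (1 / 4 * (1 - 3 / of_int R + 5 / (of_int R)\<^sup>2))\<bar> \<le> ereal (10000000000000000 / of_int R ^ 3)"
    proof (cases "R < 100000")
      case False
      obtain K where "nicf_block \<alpha> R (R + 1) K (1 / of_int R) 1"
        using block_of_signed_period(1)[OF _ per \<open>odd R\<close>] False by auto
      then interpret nicf_block \<alpha> R "R + 1" K "1 / of_int R" 1 .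
      define x where "x = 1 / real_of_int R^3"
      have mt: "main_term = 1 / 4 * (1 - 3 / of_int R + 5 / (of_int R)\<^sup>2)"
        unfolding main_term_def by (simp add: field_simps)
      have x: "(1 / real_of_int R)^3 = x" "10000000000000000 / real_of_int R^3 = 10000000000000000 * x" "0 < x"
        using R3 by (simp_all add: x_def power_divide)
      have "\<bar>inhom_rho \<alpha> - ereal main_term\<bar> \<le> ereal (10000000000000000 * x)"
        by (rule ereal_abs_diff_le[OF inhom_rho_bounds]) (use x in simp_all)
      then show ?thesis unfolding mt x(2) .
    qed (use small in simp)
  }
qed simp

end
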